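(* The Non-intrusive Optimal Disaggregation algorithm stops after a finite number of iterations, as at most $2^T-2$ constraints (of the form $\sum_{t\in\mathcal T^{(s)}}p_t\le A^{(s)}_{\mathcal T}$) can be added to the master problem.
   Context: Let $N,T\ge 1$ be integers, $[N]=\{1,\dots,N\}$, $[T]=\{1,\dots,T\}$. For each $n\in[N]$ there are given $E_n>0$ and $\underline{\mathbf x}_n,\overline{\mathbf x}_n\in\mathbb R^T$ such that $\mathcal X_n=\{\mathbf x_n\in\mathbb R^T:\ \sum_{t}x_{n,t}=E_n,\ \underline x_{n,t}\le x_{n,t}\le\overline x_{n,t}\ \forall t\}$ is nonempty; $\mathcal X=\prod_n\mathcal X_n\subset\mathbb R^{NT}$. $\mathcal P\subset\mathbb R^T$ is a set all of whose elements satisfy $\sum_{t}p_t=\sum_n E_n$ and $\sum_n\underline x_{n,t}\le p_t\le\sum_n\overline x_{n,t}$ for all $t$; $f:\mathbb R^T\to\mathbb R$ is a (possibly nonconvex) cost function. For $\mathbf p\in\mathcal P$, $\mathcal Y_{\mathbf p}=\{\mathbf x\in\mathbb R^{NT}:\sum_{n}x_{n,t}=p_t\ \forall t\}$. $P_C$ denotes Euclidean projection onto a closed convex set $C$. Alternate projections (APM) for $\mathbf p$: from a starting point $\mathbf y^{(0)}\in\mathbb R^{NT}$, for $k\ge1$, $\mathbf x^{(k)}=P_{\mathcal X}(\mathbf y^{(k-1)})$ and $\mathbf y^{(k)}=P_{\mathcal Y_{\mathbf p}}(\mathbf x^{(k)})$. Put $\nu^{(k)}_t=\frac1N(p_t-\sum_n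 x^{(k)}_{n,t})$. NI-APM$(\mathbf p)$, with parameters $B>0$, $\varepsilon_{\rm cvg}>0$, $\varepsilon_{\rm dis}>0$ and a norm $\|\cdot\|$ on $\mathbb R^{NT}$: run APM until the first index $K$ with $\|\mathbf x^{(K)}-\mathbf x^{(K-1)}\|<\varepsilon_{\rm cvg}$. If $\|\mathbf x^{(K)}-\mathbf y^{(K)}\|\le\varepsilon_{\rm dis}$, return True and the profiles $\mathbf x_n^{(K)}$. Otherwise let $\mathcal T=\{t\in[T]:B\varepsilon_{\rm cvg}<\nu^{(K)}_t\}$ and $A_{\mathcal T}=\sum_{t\in\mathcal T}\sum_{n}x^{(K)}_{n,t}$; if $A_{\mathcal T}<\sum_{t\in\mathcal T}p_t$, return False together with $(\mathcal T,A_{\mathcal T})$; else replace $\varepsilon_{\rm cvg}$ by $\varepsilon_{\rm cvg}/2$ and continue the APM iterations. Non-intrusive Optimal Disaggregation algorithm: set $\mathcal P^{(0)}=\mathcal P$, $s=0$. Repeat: if the master problem $\min_{\mathbf p\in\mathcal P^{(s)}}f(\mathbf p)$ is infeasible, exit; otherwise compute $\mathbf p^{(s)}\in\arg\min_{\mathbf p\in\mathcal P^{(s)}}f(\mathbf p)$ and call NI-APM$(\mathbf p^{(s)})$. If it returns True, stop and adopt $\mathbf p^{(s)}$. If it returns False with $(\mathcal T^{(s)},A^{(s)}_{\mathcal T})$, set $\mathcal P^{(s+1)}=\mathcal P^{(s)}\cap\{\mathbf p:\sum_{t\in\mathcal T^{(s)}}p_t\le A^{(s)}_{\mathcal T}\}$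 (one constraint is added) and $s\leftarrow s+1$.
   Formalization: For arbitrary B and ε_cvg the same set 𝒯 can be cut more than 2^T−2 times; so finite stopping and at most 2^T−2 distinct sets 𝒯 are shown for all parameters, and at most 2^T−2 added constraints only for B large and ε_cvg small (depending on B and the choice of minimizers). *)

theory Defs
  imports "HOL-Analysis.Analysis"
begin

text \<open>Users are indexed by the finite type \<open>'n\<close> and time periods by \<open>'t\<close>; a family of
  profiles is \<open>x :: real^'t^'n\<close> with entry \<open>x $ n $ t\<close>. The norm of this type is the Euclidean
  norm of \<open>\<real>\<^sup>N\<^sup>T\<close>, so \<^const>\<open>closest_point\<close> is the Euclidean projection.\<close>

definition user_set :: "real \<Rightarrow> real^'t \<Rightarrow> real^'t \<Rightarrow> (real^'t) set" where
  "user_set e l u = {x. (\<Sum>t\<in>UNIV. x $ t) = e \<and> (\<forall>t. l $ t \<le> x $ t \<and> x $ t \<le> u $ t)}"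

definition profiles :: "real^'n \<Rightarrow> real^'t^'n \<Rightarrow> real^'t^'n \<Rightarrow> (real^'t^'n) set" where
  "profiles E lo hi = {x. \<forall>n. x $ n \<in> user_set (E $ n) (lo $ n) (hi $ n)}"

definition disaggregations :: "real^'t \<Rightarrow> (real^'t^'n) set" where
  "disaggregations p = {x. \<forall>t. (\<Sum>n\<in>UNIV. x $ n $ t) = p $ t}"

definition is_norm :: "('a::real_vector \<Rightarrow> real) \<Rightarrow> bool" where
  "is_norm nrm \<longleftrightarrow> (\<forall>x. nrm x = 0 \<longleftrightarrow> x = 0) \<and> (\<forall>x y. nrm (x + y) \<le> nrm x + nrm y) \<and>
     (\<forall>c x. nrm (c *\<^sub>R x) = \<bar>c\<bar> * nrm x)"

primrec apm_y :: "'a::euclidean_space set \<Rightarrow> 'a set \<Rightarrow> 'a \<Rightarrow> nat \<Rightarrow> 'a" where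
  "apm_y X Y y0 0 = y0"
| "apm_y X Y y0 (Suc k) = closest_point Y (closest_point X (apm_y X Y y0 k))"

text \<open>Meaningful for \<open>k \<ge> 1\<close> only; the value at \<open>0\<close> is never used below.\<close>

definition apm_x :: "'a::euclidean_space set \<Rightarrow> 'a set \<Rightarrow> 'a \<Rightarrow> nat \<Rightarrow> 'a" where
  "apm_x X Y y0 k = closest_point X (apm_y X Y y0 (k - 1))"

definition imbalance :: "real^'t \<Rightarrow> real^'t^'n \<Rightarrow> 't \<Rightarrow> real" where
  "imbalance p x t = (p $ t - (\<Sum>n\<in>UNIV. x $ n $ t)) / real CARD('n)"

definition load_on :: "'t set \<Rightarrow> real^'t^'n \<Rightarrow> real" where
  "load_on S x = (\<Sum>t\<in>S. \<Sum>n\<in>UNIV. x $ n $ t)"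

text \<open>\<open>K\<close> is the first index after \<open>k\<close> at which the increment of \<open>x\<close> is below \<open>eps\<close>.\<close>

definition next_small_step :: "('a::real_vector \<Rightarrow> real) \<Rightarrow> (nat \<Rightarrow> 'a) \<Rightarrow> real \<Rightarrow> nat \<Rightarrow> nat \<Rightarrow> bool" where
  "next_small_step nrm x eps k K \<longleftrightarrow> k < K \<and> nrm (x K - x (K - 1)) < eps \<and>
     (\<forall>j. k < j \<and> j < K \<longrightarrow> \<not> nrm (x j - x (j - 1)) < eps)"

datatype ('n, 't) response = Accept "real^'t^'n" | Cut "'t set" real

text \<open>\<open>ni_apm_from X nrm B dis p y0 eps k r\<close>: when \<open>k\<close> iterations have been performed and the
  current convergence tolerance is \<open>eps\<close>, the procedure terminates with answer \<open>r\<close>.\<close>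

inductive ni_apm_from ::
  "(real^'t^'n) set \<Rightarrow> (real^'t^'n \<Rightarrow> real) \<Rightarrow> real \<Rightarrow> real \<Rightarrow> real^'t \<Rightarrow> real^'t^'n \<Rightarrow>
   real \<Rightarrow> nat \<Rightarrow> ('n::finite, 't::finite) response \<Rightarrow> bool"
  for X nrm B dis p y0 where
  accept:
  "\<lbrakk>next_small_step nrm (apm_x X (disaggregations p) y0) eps k K;
    nrm (apm_x X (disaggregations p) y0 K - apm_y X (disaggregations p) y0 K) \<le> dis\<rbrakk>
   \<Longrightarrow> ni_apm_from X nrm B dis p y0 eps k (Accept (apm_x X (disaggregations p) y0 K))"
| cut:
  "\<lbrakk>next_small_step nrm (apm_x X (disaggregations p) y0) eps k K;
    x = apm_x X (disaggregations p) y0 K;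
    \<not> nrm (x - apm_y X (disaggregations p) y0 K) \<le> dis;
    S = {t. B * eps < imbalance p x t};
    load_on S x < (\<Sum>t\<in>S. p $ t)\<rbrakk>
   \<Longrightarrow> ni_apm_from X nrm B dis p y0 eps k (Cut S (load_on S x))"
| refine:
  "\<lbrakk>next_small_step nrm (apm_x X (disaggregations p) y0) eps k K;
    x = apm_x X (disaggregations p) y0 K;
    \<not> nrm (x - apm_y X (disaggregations p) y0 K) \<le> dis;
    S = {t. B * eps < imbalance p x t};
    \<not> load_on S x < (\<Sum>t\<in>S. p $ t);
    ni_apm_from X nrm B dis p y0 (eps / 2) K r\<rbrakk>
   \<Longrightarrow> ni_apm_from X nrm B dis p y0 eps k r"

text \<open>Since \<open>x\<^sup>(\<^sup>k\<^sup>)\<close> is defined for \<open>k \<ge> 1\<close>, the first increment that can be tested is the one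
  at index \<open>2\<close>.\<close>

definition ni_apm ::
  "(real^'t^'n) set \<Rightarrow> (real^'t^'n \<Rightarrow> real) \<Rightarrow> real \<Rightarrow> real \<Rightarrow> real \<Rightarrow> real^'t \<Rightarrow> real^'t^'n \<Rightarrow>
   ('n::finite, 't::finite) response \<Rightarrow> bool" where
  "ni_apm X nrm B cvg dis p y0 r \<longleftrightarrow> ni_apm_from X nrm B dis p y0 cvg 1 r"

text \<open>A list of pairs \<open>(S, A)\<close> records the constraints \<open>\<Sum>t\<in>S. p $ t \<le> A\<close> added so far, in order;
  \<open>master P cs\<close> is the feasible set of the master problem after \<open>length cs\<close> iterations.\<close>

type_synonym 't cuts = "('t set \<times> real) list"

definition master :: "(real^'t) set \<Rightarrow> 't cuts \<Rightarrow> (real^'t) set" where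
  "master P cs = {p \<in> P. \<forall>(S, A) \<in> set cs. (\<Sum>t\<in>S. p $ t) \<le> A}"

definition master_solution :: "(real^'t) set \<Rightarrow> (real^'t \<Rightarrow> real) \<Rightarrow> 't cuts \<Rightarrow> real^'t \<Rightarrow> bool" where
  "master_solution P f cs p \<longleftrightarrow> is_arg_min f (\<lambda>q. q \<in> master P cs) p"

text \<open>The free choices made in an execution are the minimizer \<open>sel cs\<close> and the starting point
  \<open>start cs\<close> used when the constraints \<open>cs\<close> have been added. As \<open>cs\<close> contains the whole history
  of added constraints, every execution is obtained for suitable \<open>sel\<close> and \<open>start\<close>.
  \<open>nod_reaches \<dots> cs\<close>: the execution gets to a point where exactly \<open>cs\<close> have been added.\<close>

inductive nod_reaches ::
  "(real^'t^'n) set \<Rightarrow> (real^'t) set \<Rightarrow> (real^'t \<Rightarrow> real) \<Rightarrow> (real^'t^'n \<Rightarrow> real) \<Rightarrow>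
   real \<Rightarrow> real \<Rightarrow> real \<Rightarrow> ('t cuts \<Rightarrow> real^'t) \<Rightarrow> ('t cuts \<Rightarrow> real^'t^('n::finite)) \<Rightarrow>
   ('t::finite) cuts \<Rightarrow> bool"
  for X P f nrm B cvg dis sel start where
  init: "nod_reaches X P f nrm B cvg dis sel start []"
| add:
  "\<lbrakk>nod_reaches X P f nrm B cvg dis sel start cs;
    master_solution P f cs (sel cs);
    ni_apm X nrm B cvg dis (sel cs) (start cs) (Cut S A)\<rbrakk>
   \<Longrightarrow> nod_reaches X P f nrm B cvg dis sel start (cs @ [(S, A)])"

text \<open>The two ways in which the execution stops with constraints \<open>cs\<close>: infeasibility of the
  master problem, or a master solution accepted by \<^const>\<open>ni_apm\<close>.\<close>

definition nod_stops_with ::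
  "(real^'t^'n) set \<Rightarrow> (real^'t) set \<Rightarrow> (real^'t \<Rightarrow> real) \<Rightarrow> (real^'t^'n \<Rightarrow> real) \<Rightarrow>
   real \<Rightarrow> real \<Rightarrow> real \<Rightarrow> ('t cuts \<Rightarrow> real^'t) \<Rightarrow> ('t cuts \<Rightarrow> real^'t^('n::finite)) \<Rightarrow>
   ('t::finite) cuts \<Rightarrow> bool" where
  "nod_stops_with X P f nrm B cvg dis sel start cs \<longleftrightarrow>
     nod_reaches X P f nrm B cvg dis sel start cs \<and>
     (master P cs = {} \<or>
      master_solution P f cs (sel cs) \<and>
      (\<exists>x. ni_apm X nrm B cvg dis (sel cs) (start cs) (Accept x)))"

end

theory Submission
  imports Defs
begin

text \<open>Let \<open>\<nu>\<close> be the imbalance of the current APM iterate \<open>x\<close>. As \<open>\<nu>\<close> sums to zero, NI-APM halves its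
  tolerance \<open>eps\<close> only if \<open>\<nu>\<close> is of order \<open>eps\<close> but not small, so \<open>eps\<close> stays bounded away from zero
  uniformly in \<open>p\<close>. Therefore every cut is violated by its master solution by a uniform
  amount, and each set \<open>S\<close> can recur only finitely often, whatever the parameters are. For the sharp
  count, a Hoffman-type bound for \<open>X\<close> shows that \<open>\<nu>\<close> is within a constant (independent of \<open>p\<close>) times
  the last increment of its limit \<open>\<nu>\<^sub>\<infinity>\<close>. So for \<open>B\<close> large and \<open>eps\<close> small the set
  \<open>S = {t. B * eps < \<nu> t}\<close> is separated from its complement by a gap in \<open>\<nu>\<close>. First-order
  optimality of the projection then forces \<open>x\<close> to maximise the load on \<open>S\<close> over \<open>X\<close>. Such a cut
  depends on \<open>S\<close> only and hence cannot be repeated.\<close>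

section \<open>Equivalence of an arbitrary norm with the Euclidean one\<close>

lemma is_norm_zero: "is_norm nrm \<Longrightarrow> nrm 0 = 0"
  by (simp add: is_norm_def)

lemma is_norm_minus: "is_norm nrm \<Longrightarrow> nrm (- x) = nrm x"
  unfolding is_norm_def by (metis abs_minus_cancel abs_one mult_1 scaleR_minus1_left)

lemma is_norm_nonneg:
  assumes "is_norm nrm"
  shows "0 \<le> nrm x"
proof -
  have "nrm (x + - x) \<le> nrm x + nrm (- x)"
    using assms unfolding is_norm_def by blast
  then show ?thesis
    using is_norm_zero[OF assms] is_norm_minus[OF assms, of x] by simp
qed

lemma is_norm_diff_le:
  assumes "is_norm nrm"
  shows "\<bar>nrm x - nrm y\<bar> \<le> nrm (x - y)"
proof -
  have "nrm (x - y + y) \<le> nrm (x - y) + nrm y" "nrm (y - x + x) \<le> nrm (y - x) + nrm x"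
    using assms unfolding is_norm_def by blast+
  moreover have "nrm (y - x) = nrm (x - y)"
    using is_norm_minus[OF assms, of "x - y"] by simp
  ultimately show ?thesis by simp
qed

lemma is_norm_upper:
  fixes nrm :: "'a::euclidean_space \<Rightarrow> real"
  assumes "is_norm nrm"
  obtains c where "c > 0" "\<And>x. nrm x \<le> c * norm x"
proof
  \<comment> \<open>The summand 1 makes the constant positive from nonnegativity of
    \<open>nrm\<close> alone.\<close>
  let ?c = "(\<Sum>b\<in>Basis. nrm b) + 1"
  show "?c > 0"
    by (smt (verit) is_norm_nonneg[OF assms] sum_nonneg)
  fix x :: 'a
  have sum_le: "nrm (\<Sum>b\<in>A. f b) \<le> (\<Sum>b\<in>A. nrm (f b))" if "finite A" for A and f :: "'a \<Rightarrow> 'a"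
    using that
  proof (induction A)
    case empty
    then show ?case by (simp add: is_norm_zero[OF assms])
  next
    case (insert b A)
    have "nrm (f b + sum f A) \<le> nrm (f b) + nrm (sum f A)"
      using assms unfolding is_norm_def by blast
    with insert show ?case by simp
  qed
  have "nrm x = nrm (\<Sum>b\<in>Basis. (x \<bullet> b) *\<^sub>R b)"
    by (simp add: euclidean_representation)
  also have "\<dots> \<le> (\<Sum>b\<in>Basis. nrm ((x \<bullet> b) *\<^sub>R b))"
    by (rule sum_le) simp
  also have "\<dots> = (\<Sum>b\<in>Basis. \<bar>x \<bullet> b\<bar> * nrm b)"
    using assms unfolding is_norm_def by simp
  also have "\<dots> \<le> (\<Sum>b\<in>Basis. norm x * nrm b)"
    by (intro sum_mono mult_right_mono is_norm_nonneg[OF assms] Basis_le_norm)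
  also have "\<dots> = norm x * (\<Sum>b\<in>Basis. nrm b)"
    by (rule sum_distrib_left[symmetric])
  also have "\<dots> \<le> ?c * norm x"
    by (simp add: algebra_simps)
  finally show "nrm x \<le> ?c * norm x" .
qed

text \<open>The upper bound makes \<open>nrm\<close> Lipschitz, so it attains a positive minimum on
  the compact unit sphere; homogeneity extends the bound to all vectors.\<close>

lemma is_norm_lower:
  fixes nrm :: "'a::euclidean_space \<Rightarrow> real"
  assumes "is_norm nrm"
  obtains c where "c > 0" "\<And>x. norm x \<le> c * nrm x"
proof -
  obtain d where d: "d > 0" "\<And>x. nrm x \<le> d * norm x"
    using is_norm_upper[OF assms] by blast
  have "d-lipschitz_on UNIV nrm"
  proof (rule lipschitz_onI)
    show "dist (nrm x) (nrm y) \<le> d * dist x y" for x y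
      using is_norm_diff_le[OF assms, of x y] d(2)[of "x - y"] by (simp add: dist_norm)
  qed (use d in simp)
  then have cont: "continuous_on (sphere 0 1) nrm"
    using lipschitz_on_continuous_on continuous_on_subset by blast
  have "(SOME b::'a. b \<in> Basis) \<in> sphere 0 1"
    by (simp add: norm_Basis[OF SOME_Basis])
  then have "sphere (0::'a) 1 \<noteq> {}" by blast
  then obtain m where m: "m \<in> sphere (0::'a) 1" "\<And>x. x \<in> sphere 0 1 \<Longrightarrow> nrm m \<le> nrm x"
    using continuous_attains_inf[OF compact_sphere _ cont] by blast
  have "nrm m \<noteq> 0"
    using m(1) assms unfolding is_norm_def by force
  with is_norm_nonneg[OF assms, of m] have pos: "nrm m > 0" by simp
  show thesis
  proof
    show "1 / nrm m > 0" using pos by simp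
    fix x :: 'a
    show "norm x \<le> 1 / nrm m * nrm x"
    proof (cases "x = 0")
      case True
      then show ?thesis by (simp add: is_norm_zero[OF assms])
    next
      case False
      have "nrm m \<le> nrm ((1 / norm x) *\<^sub>R x)"
        using False by (intro m) simp
      also have "\<dots> = \<bar>1 / norm x\<bar> * nrm x"
        using assms unfolding is_norm_def by blast
      finally show ?thesis
        using False pos by (simp add: field_simps)
    qed
  qed
qed

section \<open>Aggregate load, gap, and projection onto the disaggregations of
  \<open>p\<close>\<close>

definition total :: "real^'t^'n::finite \<Rightarrow> real^'t" where
  "total x = (\<Sum>n\<in>UNIV. x $ n)"

text \<open>This is \<nu> as a vector: adding it to the profile of every user, that is adding
  \<open>vec (gap p x)\<close>, makes the total equal to \<open>p\<close>.\<close>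

definition gap :: "real^'t \<Rightarrow> real^'t^'n::finite \<Rightarrow> real^'t" where
  "gap p x = (1 / real CARD('n)) *\<^sub>R (p - total x)"

lemma total_nth: "total x $ t = (\<Sum>n\<in>UNIV. x $ n $ t)"
  by (simp add: total_def)

lemma gap_nth: "gap p x $ t = imbalance p x t"
  by (simp add: gap_def imbalance_def total_nth)

lemma total_gap:
  fixes x :: "real^'t^'n::finite"
  shows "real CARD('n) *\<^sub>R gap p x = p - total x"
  by (simp add: gap_def)

lemma load_on_eq: "load_on S x = (\<Sum>t\<in>S. total x $ t)"
  by (simp add: load_on_def total_nth)

lemma linear_total: "linear total"
  by (auto intro!: linearI simp: total_def sum.distrib scaleR_sum_right)

lemmas total_add = linear_add[OF linear_total]
  and total_diff = linear_diff[OF linear_total]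
  and total_scaleR = linear_scale[OF linear_total]

lemma total_vec: "total (vec v :: real^'t^'n::finite) = real CARD('n) *\<^sub>R v"
  by (simp add: total_def sum_constant_scaleR del: sum_constant)

text \<open>So \<open>vec\<close> is the adjoint of \<open>total\<close>, which turns inner products
  of families of profiles into inner products over the time periods.\<close>

lemma inner_vec_left: "vec v \<bullet> x = v \<bullet> total x"
  by (simp add: inner_vec_def[of "vec v" x] total_def inner_sum_right)

lemma norm_total_le:
  fixes x :: "real^'t^'n::finite"
  shows "norm (total x) \<le> real CARD('n) * norm x"
  unfolding total_def
  by (rule order_trans[OF norm_sum sum_bounded_above]) (simp add: Finite_Cartesian_Product.norm_nth_le)

lemma norm_vec_le:
  fixes v :: "real^'t"
  shows "norm (vec v :: real^'t^'n::finite) \<le> real CARD('n) * norm v"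
  unfolding norm_vec_def[of "vec v"]
  by (rule order_trans[OF L2_set_le_sum]) simp_all

lemma mem_disaggregations: "x \<in> disaggregations p \<longleftrightarrow> total x = p"
  by (simp add: disaggregations_def vec_eq_iff total_nth)

lemma disaggregations_eq_vimage: "disaggregations p = total -` {p}"
  by (auto simp: mem_disaggregations)

lemma closed_disaggregations: "closed (disaggregations p)"
  unfolding disaggregations_eq_vimage
  by (intro closed_vimage closed_singleton linear_continuous_on
      linear_total[unfolded linear_conv_bounded_linear])

lemma convex_disaggregations: "convex (disaggregations p)"
  unfolding disaggregations_eq_vimage
  by (intro convex_linear_vimage linear_total convex_singleton)

text \<open>The correction lies in the range of \<open>vec\<close>, hence is orthogonal to the
  kernel of \<open>total\<close>, the direction space of the disaggregations. Pythagoras then gives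
  minimality.\<close>

lemma closest_point_disaggregations:
  fixes x :: "real^'t^'n::finite"
  shows "closest_point (disaggregations p) x = x + vec (gap p x)"
proof -
  let ?y = "x + vec (gap p x)"
  have y: "?y \<in> disaggregations p"
    by (simp add: mem_disaggregations total_add total_vec total_gap)
  have "dist x ?y \<le> dist x z" if "z \<in> disaggregations p" for z
  proof -
    have "(?y - x) \<bullet> (z - ?y) = gap p x \<bullet> total (z - ?y)"
      by (simp add: inner_vec_left)
    also have "\<dots> = 0"
      using that y by (simp add: total_diff mem_disaggregations)
    finally have "orthogonal (?y - x) (z - ?y)"
      by (simp add: orthogonal_def)
    then have "(norm (?y - x + (z - ?y)))\<^sup>2 = (norm (?y - x))\<^sup>2 + (norm (z - ?y))\<^sup>2"
      by (rule norm_add_Pythagorean)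
    then have "(norm (?y - x))\<^sup>2 \<le> (norm (z - x))\<^sup>2" by simp
    then show ?thesis
      by (metis dist_commute dist_norm norm_ge_zero power2_le_imp_le)
  qed
  then show ?thesis
    using closest_point_unique[OF convex_disaggregations closed_disaggregations y] by simp
qed

section \<open>Vanishing increments of alternate projections\<close>

lemma closest_point_pythagoras:
  assumes "convex S" "closed S" "z \<in> S"
  shows "(norm (closest_point S a - a))\<^sup>2 + (norm (z - closest_point S a))\<^sup>2 \<le> (norm (z - a))\<^sup>2"
proof -
  have "(norm (z - a))\<^sup>2 = (norm (closest_point S a - a))\<^sup>2 + (norm (z - closest_point S a))\<^sup>2
      - 2 * ((a - closest_point S a) \<bullet> (z - closest_point S a))"
    by (simp add: power2_norm_eq_inner algebra_simps inner_commute)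
  then show ?thesis
    using closest_point_dot[OF assms] by simp
qed

lemma apm_y_eq_closest_point: "k \<ge> 1 \<Longrightarrow> apm_y X Y y0 k = closest_point Y (apm_x X Y y0 k)"
  by (cases k) (simp_all add: apm_x_def)

lemma apm_x_Suc: "k \<ge> 1 \<Longrightarrow> apm_x X Y y0 (Suc k) = closest_point X (closest_point Y (apm_x X Y y0 k))"
  by (cases k) (simp_all add: apm_x_def)

lemma apm_x_mem: "closed X \<Longrightarrow> X \<noteq> {} \<Longrightarrow> apm_x X Y y0 k \<in> X"
  by (simp add: apm_x_def closest_point_in_set)

text \<open>The squared distance between the two iterates drops by at least the squared increment.\<close>

lemma apm_increment_tendsto_zero:
  assumes X: "convex X" "closed X" "X \<noteq> {}" and Y: "closed Y" "Y \<noteq> {}"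
  shows "(\<lambda>k. norm (apm_x X Y y0 (Suc (Suc k)) - apm_x X Y y0 (Suc k))) \<longlonglongrightarrow> 0"
proof -
  define x where "x k = apm_x X Y y0 (Suc k)" for k
  define y where "y k = closest_point Y (x k)" for k
  define d where "d k = (norm (x k - y k))\<^sup>2" for k
  have x_Suc: "x (Suc k) = closest_point X (y k)" for k
    by (simp add: x_def y_def apm_x_Suc)
  have x_mem: "x k \<in> X" for k
    by (simp add: x_def apm_x_mem X)
  have step: "d (Suc k) + (norm (x (Suc k) - x k))\<^sup>2 \<le> d k" for k
  proof -
    \<comment> \<open>Going back from \<open>y (Suc k)\<close> to \<open>y k\<close> cannot decrease
      the distance to \<open>x (Suc k)\<close>; the Pythagorean inequality at
      \<open>x (Suc k)\<close>, the projection of \<open>y k\<close>, then compares with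
      \<open>x k\<close>.\<close>
    have "dist (x (Suc k)) (y (Suc k)) \<le> dist (x (Suc k)) (y k)"
      unfolding y_def by (intro closest_point_le closest_point_in_set Y)
    then have "d (Suc k) \<le> (norm (x (Suc k) - y k))\<^sup>2"
      by (simp add: d_def dist_norm power_mono)
    moreover have "(norm (x (Suc k) - y k))\<^sup>2 + (norm (x k - x (Suc k)))\<^sup>2 \<le> d k"
      using closest_point_pythagoras[OF X(1,2) x_mem, of "y k" k] by (simp only: x_Suc d_def)
    ultimately show ?thesis
      unfolding norm_minus_commute[of "x (Suc k)" "x k"] by linarith
  qed
  \<comment> \<open>Telescoping \<open>step\<close> bounds all partial sums by
    \<open>d 0\<close>.\<close>
  have "summable (\<lambda>k. (norm (x (Suc k) - x k))\<^sup>2)"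
  proof (rule summableI_nonneg_bounded)
    show "(\<Sum>i<k. (norm (x (Suc i) - x i))\<^sup>2) \<le> d 0" for k
    proof -
      have "(\<Sum>i<k. (norm (x (Suc i) - x i))\<^sup>2) + d k \<le> d 0"
      proof (induction k)
        case (Suc k)
        then show ?case using step[of k] by simp
      qed simp
      moreover have "d k \<ge> 0" by (simp add: d_def)
      ultimately show ?thesis by simp
    qed
  qed simp
  then have "(\<lambda>k. (norm (x (Suc k) - x k))\<^sup>2) \<longlonglongrightarrow> 0"
    by (rule summable_LIMSEQ_zero)
  then have "(\<lambda>k. sqrt ((norm (x (Suc k) - x k))\<^sup>2)) \<longlonglongrightarrow> sqrt 0"
    by (rule tendsto_real_sqrt)
  then show ?thesis by (simp add: x_def)
qed

section \<open>The inner stopping rule, and determinism of both procedures\<close>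

lemma next_small_step_unique:
  "next_small_step nrm x eps k K \<Longrightarrow> next_small_step nrm x eps k K' \<Longrightarrow> K = K'"
  unfolding next_small_step_def by (cases K K' rule: linorder_cases) blast+

lemma next_small_step_exists:
  fixes x :: "nat \<Rightarrow> 'a::euclidean_space"
  assumes nrm: "is_norm nrm" and "eps > 0"
    and lim: "(\<lambda>k. norm (x (Suc (Suc k)) - x (Suc k))) \<longlonglongrightarrow> 0"
  shows "\<exists>K. next_small_step nrm x eps k K"
proof -
  obtain c where c: "c > 0" "\<And>z. nrm z \<le> c * norm z"
    using is_norm_upper[OF nrm] by blast
  have "eps / c > 0" using assms c by simp
  then obtain N where N: "\<And>j. j \<ge> N \<Longrightarrow> norm (x (Suc (Suc j)) - x (Suc j)) < eps / c"
    using LIMSEQ_D[OF lim] by force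
  let ?P = "\<lambda>j. k < j \<and> nrm (x j - x (j - 1)) < eps"
  \<comment> \<open>This index exceeds \<open>k\<close>, and its predecessor is at least 1, so the
    increment is one of those covered by \<open>lim\<close>.\<close>
  have "norm (x (Suc (Suc (N + k))) - x (Suc (N + k))) < eps / c"
    by (rule N) simp
  then have "?P (Suc (Suc (N + k)))"
    using c(1) c(2)[of "x (Suc (Suc (N + k))) - x (Suc (N + k))"]
    by (simp add: field_simps)
  then have "?P (LEAST j. ?P j)"
    by (rule LeastI)
  moreover have "\<not> ?P j" if "j < (LEAST j. ?P j)" for j
    using that by (rule not_less_Least)
  ultimately show ?thesis
    unfolding next_small_step_def by blast
qed

text \<open>Once \<open>K\<close> is unique, the premises of the three rules exclude each
  other.\<close>

lemma ni_apm_from_deterministic: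
  "ni_apm_from X nrm B dis p y0 eps k r \<Longrightarrow> ni_apm_from X nrm B dis p y0 eps k r' \<Longrightarrow> r = r'"
proof (induction arbitrary: r' rule: ni_apm_from.induct)
  case (accept eps k K)
  from accept.prems show ?case
    by cases (use accept.hyps next_small_step_unique in blast)+
next
  case (cut eps k K x S)
  from cut.prems show ?case
    by cases (use cut.hyps next_small_step_unique in blast)+
next
  case (refine eps k K x S r)
  from refine.prems show ?case
    by cases (use refine.hyps refine.IH next_small_step_unique in blast)+
qed

text \<open>For fixed \<open>sel\<close> and \<open>start\<close> the reachable lists form a chain
  with at most one of each length. A bound on lengths thus yields finiteness.\<close>

lemma nod_reaches_deterministic:
  "nod_reaches X P f nrm B cvg dis sel start cs \<Longrightarrow> nod_reaches X P f nrm B cvg dis sel start cs' \<Longrightarrow>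
    length cs = length cs' \<Longrightarrow> cs = cs'"
proof (induction arbitrary: cs' rule: nod_reaches.induct)
  case init
  then show ?case by simp
next
  case (add cs S A)
  from add.prems(1) show ?case
  proof cases
    case init
    then show ?thesis using add.prems by simp
  next
    case (add ds S' A')
    then have "cs = ds"
      using add.IH add.prems by simp
    then show ?thesis
      using add add.hyps ni_apm_from_deterministic unfolding ni_apm_def by blast
  qed
qed

section \<open>Sign cones and a uniform bound of Hoffman type\<close>

lemma norm_le_sum_entries:
  fixes x :: "real^'t^'n::finite"
  shows "norm x \<le> (\<Sum>n\<in>UNIV. \<Sum>t\<in>UNIV. \<bar>x $ n $ t\<bar>)"
proof -
  have "norm x \<le> (\<Sum>n\<in>UNIV. norm (x $ n))"
    unfolding norm_vec_def[of x] by (rule L2_set_le_sum) simp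
  also have "\<dots> \<le> (\<Sum>n\<in>UNIV. \<Sum>t\<in>UNIV. \<bar>x $ n $ t\<bar>)"
    by (intro sum_mono norm_le_l1_cart)
  finally show ?thesis .
qed

lemma abs_entry_le_norm:
  fixes x :: "real^'t^'n::finite"
  shows "\<bar>x $ n $ t\<bar> \<le> norm x"
  using Finite_Cartesian_Product.norm_nth_le[of "x $ n" t] Finite_Cartesian_Product.norm_nth_le[of x n]
  by simp

lemma sum_minus_load_on:
  fixes x :: "real^'t^'n::finite"
  shows "(\<Sum>t\<in>S. p $ t) - load_on S x = real CARD('n) * (\<Sum>t\<in>S. imbalance p x t)"
  by (simp add: load_on_def imbalance_def sum_subtractf sum_divide_distrib[symmetric])

text \<open>\<open>Q\<close> and \<open>M\<close> hold the positions where positive and negative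
  entries are permitted. Differences of elements of the profile polytope lie in such cones, and
  there are only finitely many of them.\<close>

definition sign_cone :: "('n \<times> 't) set \<Rightarrow> ('n \<times> 't) set \<Rightarrow> (real^'t^'n) set" where
  "sign_cone Q M = {e. (\<forall>n. (\<Sum>t\<in>UNIV. e $ n $ t) = 0) \<and>
     (\<forall>n t. ((n, t) \<notin> Q \<longrightarrow> e $ n $ t \<le> 0) \<and> ((n, t) \<notin> M \<longrightarrow> 0 \<le> e $ n $ t))}"

lemma closed_sign_cone: "closed (sign_cone Q M)"
  unfolding sign_cone_def
  by (intro closed_Collect_conj closed_Collect_all closed_Collect_imp closed_Collect_le
      closed_Collect_eq open_Collect_const continuous_intros)

lemma sign_cone_scaleR: "e \<in> sign_cone Q M \<Longrightarrow> 0 \<le> c \<Longrightarrow> c *\<^sub>R e \<in> sign_cone Q M"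
  by (auto simp: sign_cone_def sum_distrib_left[symmetric] mult_nonneg_nonpos)

lemma continuous_on_total: "continuous_on S total"
  by (intro linear_continuous_on linear_total[unfolded linear_conv_bounded_linear])

text \<open>On the compact unit slice of the cone, \<open>norm (total e)\<close> has a positive
  minimum; its reciprocal is the constant, by homogeneity. If the slice is empty, the cone contains
  at most 0.\<close>

lemma sign_cone_norm_le:
  fixes Q M :: "('n::finite \<times> 't::finite) set"
  assumes "\<And>e::real^'t^'n. e \<in> sign_cone Q M \<Longrightarrow> total e = 0 \<Longrightarrow> e = 0"
  shows "\<exists>C>0. \<forall>e::real^'t^'n \<in> sign_cone Q M. norm e \<le> C * norm (total e)"
proof (cases "sign_cone Q M \<inter> sphere 0 1 = ({} :: (real^'t^'n) set)")
  case True
  have "e = 0" if "e \<in> sign_cone Q M" for e :: "real^'t^'n"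
  proof (rule ccontr)
    assume "e \<noteq> 0"
    then have "(1 / norm e) *\<^sub>R e \<in> sign_cone Q M \<inter> sphere 0 1"
      using sign_cone_scaleR[OF that, of "1 / norm e"] by simp
    with True show False by blast
  qed
  then show ?thesis
    by (metis mult_1 norm_zero norm_ge_zero zero_less_one)
next
  case False
  have "compact (sign_cone Q M \<inter> sphere 0 1 :: (real^'t^'n) set)"
    by (intro closed_Int_compact closed_sign_cone compact_sphere)
  from continuous_attains_inf[OF this False continuous_on_norm[OF continuous_on_total]]
  obtain m :: "real^'t^'n" where m: "m \<in> sign_cone Q M" "norm m = 1"
    and min: "\<And>e. e \<in> sign_cone Q M \<Longrightarrow> norm e = 1 \<Longrightarrow> norm (total m) \<le> norm (total e)"
    by auto
  have pos: "norm (total m) > 0"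
    using assms[OF m(1)] m(2) by auto
  have "norm e \<le> 1 / norm (total m) * norm (total e)" if "e \<in> sign_cone Q M" for e :: "real^'t^'n"
  proof (cases "e = 0")
    case False
    have "norm (total m) \<le> norm (total ((1 / norm e) *\<^sub>R e))"
      using sign_cone_scaleR[OF that, of "1 / norm e"] False by (intro min) auto
    also have "\<dots> = norm (total e) / norm e"
      by (simp add: total_scaleR)
    finally show ?thesis using pos False by (simp add: field_simps)
  qed simp
  with pos show ?thesis
    by (intro exI[of _ "1 / norm (total m)"]) auto
qed

lemma sign_cone_norm_le_uniform:
  "\<exists>C>0. \<forall>Q M. (\<forall>e::real^'t^'n::finite. e \<in> sign_cone Q M \<longrightarrow> total e = 0 \<longrightarrow> e = 0) \<longrightarrow>
     (\<forall>e::real^'t^'n \<in> sign_cone Q M. norm e \<le> C * norm (total e))"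
proof -
  let ?inj = "\<lambda>Z::('n \<times> 't) set \<times> ('n \<times> 't) set.
    \<forall>e::real^'t^'n. e \<in> sign_cone (fst Z) (snd Z) \<longrightarrow> total e = 0 \<longrightarrow> e = 0"
  let ?bd = "\<lambda>Z C. \<forall>e::real^'t^'n \<in> sign_cone (fst Z) (snd Z). norm e \<le> C * norm (total e)"
  have "\<forall>Z. \<exists>C>0. ?inj Z \<longrightarrow> ?bd Z C"
  proof
    fix Z
    show "\<exists>C>0. ?inj Z \<longrightarrow> ?bd Z C"
    proof (cases "?inj Z")
      case True
      then show ?thesis using sign_cone_norm_le[of "fst Z" "snd Z"] by blast
    next
      \<comment> \<open>Nothing is claimed for such a cone; a positive value is chosen so that the
        maximum below stays positive.\<close>
      case False
      then show ?thesis using zero_less_one by blast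
    qed
  qed
  from choice[OF this] obtain C where C: "\<And>Z. C Z > 0" "\<And>Z. ?inj Z \<Longrightarrow> ?bd Z (C Z)"
    by blast
  show ?thesis
  proof (intro exI[of _ "Max (range C)"] conjI allI impI ballI)
    show "Max (range C) > 0"
      using C(1) by (subst Max_gr_iff) auto
    fix Q M and e :: "real^'t^'n"
    assume "\<forall>e::real^'t^'n. e \<in> sign_cone Q M \<longrightarrow> total e = 0 \<longrightarrow> e = 0" "e \<in> sign_cone Q M"
    then have "norm e \<le> C (Q, M) * norm (total e)"
      using C(2)[of "(Q, M)"] by auto
    also have "\<dots> \<le> Max (range C) * norm (total e)"
      by (intro mult_right_mono Max_ge) auto
    finally show "norm e \<le> Max (range C) * norm (total e)" .
  qed
qed

lemma master_solutionD:
  assumes "master_solution P f cs p"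
  shows "p \<in> P" "(S, A) \<in> set cs \<Longrightarrow> (\<Sum>t\<in>S. p $ t) \<le> A"
  using assms by (auto simp: master_solution_def is_arg_min_def master_def)

lemma card_proper_nonempty_sets: "card (UNIV - {{}, UNIV :: 't::finite set}) = 2 ^ CARD('t) - 2"
  by (subst card_Diff_subset) (simp_all add: card_UNIV_set)

section \<open>The profile polytope and one step of alternate projections on it\<close>

locale disaggregation_problem =
  fixes E :: "real^'n::finite" and lo hi :: "real^'t::finite^'n"
    and P :: "(real^'t) set" and nrm :: "real^'t^'n \<Rightarrow> real"
  assumes user_set_nonempty: "user_set (E $ n) (lo $ n) (hi $ n) \<noteq> {}"
    and sum_P: "p \<in> P \<Longrightarrow> (\<Sum>t\<in>UNIV. p $ t) = (\<Sum>n\<in>UNIV. E $ n)"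
    and P_bounds: "p \<in> P \<Longrightarrow> (\<Sum>n\<in>UNIV. lo $ n $ t) \<le> p $ t \<and> p $ t \<le> (\<Sum>n\<in>UNIV. hi $ n $ t)"
    and nrm: "is_norm nrm"
begin

abbreviation X :: "(real^'t^'n) set" where "X \<equiv> profiles E lo hi"

lemma mem_X: "x \<in> X \<longleftrightarrow> (\<forall>n. (\<Sum>t\<in>UNIV. x $ n $ t) = E $ n) \<and>
    (\<forall>n t. lo $ n $ t \<le> x $ n $ t \<and> x $ n $ t \<le> hi $ n $ t)"
  by (auto simp: profiles_def user_set_def)

lemma X_nonempty: "X \<noteq> {}"
proof -
  have "\<exists>g. \<forall>n. g n \<in> user_set (E $ n) (lo $ n) (hi $ n)"
    by (rule choice) (use user_set_nonempty in blast)
  then obtain g where "\<forall>n. g n \<in> user_set (E $ n) (lo $ n) (hi $ n)"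
    by blast
  then have "(\<chi> n. g n) \<in> X" by (simp add: profiles_def)
  then show ?thesis by blast
qed

lemma closed_X: "closed X"
proof -
  have "X = {x. (\<forall>n. (\<Sum>t\<in>UNIV. x $ n $ t) = E $ n) \<and>
    (\<forall>n t. lo $ n $ t \<le> x $ n $ t \<and> x $ n $ t \<le> hi $ n $ t)}"
    using mem_X by blast
  moreover have "closed \<dots>"
    by (intro closed_Collect_conj closed_Collect_all closed_Collect_le closed_Collect_eq
        continuous_intros)
  ultimately show ?thesis by simp
qed

lemma convex_X: "convex X"
proof (rule convexI)
  fix x y and u v :: real
  assume x: "x \<in> X" and y: "y \<in> X" and uv: "0 \<le> u" "0 \<le> v" "u + v = 1"
  have E: "u * (E $ n) + v * (E $ n) = E $ n" for n
    using uv by (metis distrib_right mult_1)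
  have "(\<Sum>t\<in>UNIV. (u *\<^sub>R x + v *\<^sub>R y) $ n $ t) = E $ n" for n
    using x y E by (simp add: mem_X sum.distrib sum_distrib_left[symmetric])
  moreover have "lo $ n $ t \<le> (u *\<^sub>R x + v *\<^sub>R y) $ n $ t \<and> (u *\<^sub>R x + v *\<^sub>R y) $ n $ t \<le> hi $ n $ t" for n t
  proof -
    have "x $ n $ t \<in> {lo $ n $ t..hi $ n $ t}" "y $ n $ t \<in> {lo $ n $ t..hi $ n $ t}"
      using x y by (auto simp: mem_X)
    from convexD[OF convex_real_interval(5) this uv] show ?thesis by simp
  qed
  ultimately show "u *\<^sub>R x + v *\<^sub>R y \<in> X" by (simp add: mem_X)
qed

lemma compact_X: "compact X"
proof -
  have "norm x \<le> (\<Sum>n\<in>UNIV. \<Sum>t\<in>UNIV. \<bar>lo $ n $ t\<bar> + \<bar>hi $ n $ t\<bar>)" if "x \<in> X" for x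
  proof (rule order_trans[OF norm_le_sum_entries], intro sum_mono)
    fix n t
    have "lo $ n $ t \<le> x $ n $ t" "x $ n $ t \<le> hi $ n $ t"
      using that by (auto simp: mem_X)
    then show "\<bar>x $ n $ t\<bar> \<le> \<bar>lo $ n $ t\<bar> + \<bar>hi $ n $ t\<bar>" by arith
  qed
  then have "bounded X"
    unfolding bounded_iff by blast
  with closed_X show ?thesis by (simp add: compact_eq_bounded_closed)
qed

lemma sum_total: "x \<in> X \<Longrightarrow> (\<Sum>t\<in>UNIV. total x $ t) = (\<Sum>n\<in>UNIV. E $ n)"
  unfolding total_nth by (subst sum.swap) (simp add: mem_X)

lemma load_on_UNIV: "x \<in> X \<Longrightarrow> load_on UNIV x = (\<Sum>n\<in>UNIV. E $ n)"
  by (simp add: load_on_eq sum_total)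

lemma sum_imbalance: "x \<in> X \<Longrightarrow> p \<in> P \<Longrightarrow> (\<Sum>t\<in>UNIV. imbalance p x t) = 0"
  using sum_minus_load_on[of p UNIV x] by (simp add: load_on_UNIV sum_P)

text \<open>Among the \<open>w \<in> X\<close> with the prescribed total, the one nearest to \<open>x\<close> in \<open>\<ell>\<^sub>1\<close>-norm is such that
  no nonzero vector with zero row and column sums has the signs of \<open>w - x\<close>: a small multiple of
  it could be subtracted from \<open>w\<close>.\<close>

lemma nearby_profile_with_total:
  "\<exists>C>0. \<forall>x\<in>X. \<forall>w0\<in>X. \<exists>w\<in>X. total w = total w0 \<and> norm (w - x) \<le> C * norm (total w0 - total x)"
proof -
  obtain C where "C > 0" and C: "\<And>Q M e. (\<forall>e::real^'t^'n. e \<in> sign_cone Q M \<longrightarrow> total e = 0 \<longrightarrow> e = 0) \<Longrightarrow>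
     (e::real^'t^'n) \<in> sign_cone Q M \<Longrightarrow> norm e \<le> C * norm (total e)"
    using sign_cone_norm_le_uniform by metis
  have "\<exists>w\<in>X. total w = total w0 \<and> norm (w - x) \<le> C * norm (total w0 - total x)"
    if x: "x \<in> X" and w0: "w0 \<in> X" for x w0
  proof -
    \<comment> \<open>As long as no entry of \<open>w - x\<close> changes sign, this distance is
      linear in \<open>w\<close>, so its change along a vector of matching signs is exact.\<close>
    define h where "h w = (\<Sum>n\<in>UNIV. \<Sum>t\<in>UNIV. \<bar>w $ n $ t - x $ n $ t\<bar>)" for w :: "real^'t^'n"
    have "compact (X \<inter> disaggregations (total w0))"
      by (intro compact_Int_closed compact_X closed_disaggregations)
    moreover have "X \<inter> disaggregations (total w0) \<noteq> {}"
      using w0 by (auto simp: mem_disaggregations)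
    moreover have "continuous_on (X \<inter> disaggregations (total w0)) h"
      unfolding h_def by (intro continuous_intros)
    ultimately obtain w where "w \<in> X \<inter> disaggregations (total w0)"
      and "\<forall>v\<in>X \<inter> disaggregations (total w0). h w \<le> h v"
      using continuous_attains_inf by blast
    then have w: "w \<in> X" "total w = total w0"
      and min: "\<And>v. v \<in> X \<Longrightarrow> total v = total w0 \<Longrightarrow> h w \<le> h v"
      by (simp_all add: mem_disaggregations)
    define Q where "Q = {(n, t). 0 < w $ n $ t - x $ n $ t}"
    define M where "M = {(n, t). w $ n $ t - x $ n $ t < 0}"
    have mem: "w - x \<in> sign_cone Q M"
      using w(1) x by (auto simp: sign_cone_def Q_def M_def mem_X sum_subtractf)
    \<comment> \<open>A nonzero such \<open>e\<close> would allow moving \<open>w\<close> towards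
      \<open>x\<close> inside \<open>X\<close> with the same total, against the minimality of
      \<open>w\<close>.\<close>
    have "e = 0" if e: "e \<in> sign_cone Q M" "total e = 0" for e :: "real^'t^'n"
    proof (rule ccontr)
      assume "e \<noteq> 0"
      then obtain n0 t0 where nz: "e $ n0 $ t0 \<noteq> 0" by (auto simp: vec_eq_iff)
      define d where "d = w - x"
      have sgn: "e $ n $ t > 0 \<Longrightarrow> d $ n $ t > 0" "e $ n $ t < 0 \<Longrightarrow> d $ n $ t < 0" for n t
      proof -
        have "(n, t) \<notin> Q \<Longrightarrow> e $ n $ t \<le> 0" "(n, t) \<notin> M \<Longrightarrow> 0 \<le> e $ n $ t"
          using e(1) by (simp_all add: sign_cone_def)
        then show "e $ n $ t > 0 \<Longrightarrow> d $ n $ t > 0" "e $ n $ t < 0 \<Longrightarrow> d $ n $ t < 0"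
          unfolding Q_def M_def d_def vector_minus_component by (auto simp: not_less[symmetric])
      qed
      \<comment> \<open>The step length at which the entry of \<open>d - s *\<^sub>R e\<close>
        reaches zero. Where \<open>e\<close> vanishes every step is harmless, and 1 is a positive
        placeholder.\<close>
      let ?r = "\<lambda>n t. if e $ n $ t = 0 then 1 else \<bar>d $ n $ t\<bar> / \<bar>e $ n $ t\<bar>"
      define s where "s = Min (range (\<lambda>(n, t). ?r n t))"
      have "?r n t > 0" for n t
        using sgn[of n t] by (cases "e $ n $ t" "0::real" rule: linorder_cases) (simp_all add: divide_neg_neg)
      then have "s > 0" unfolding s_def by (subst Min_gr_iff) auto
      have s_le: "s * \<bar>e $ n $ t\<bar> \<le> \<bar>d $ n $ t\<bar>" for n t
      proof (cases "e $ n $ t = 0")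
        case False
        have "s \<le> ?r n t"
          unfolding s_def by (rule Min_le) (auto intro!: image_eqI[of _ _ "(n, t)"])
        with False show ?thesis by (simp add: field_simps)
      qed simp
      \<comment> \<open>Every entry of \<open>v\<close> lies between those of \<open>x\<close> and
        \<open>w\<close>, which preserves the bounds; zero row and column sums of \<open>e\<close>
        preserve energies and total.\<close>
      define v where "v = w - s *\<^sub>R e"
      have abs_v: "\<bar>v $ n $ t - x $ n $ t\<bar> = \<bar>w $ n $ t - x $ n $ t\<bar> - s * \<bar>e $ n $ t\<bar>"
        and between: "min (x $ n $ t) (w $ n $ t) \<le> v $ n $ t \<and> v $ n $ t \<le> max (x $ n $ t) (w $ n $ t)" for n t
      proof -
        have d: "d $ n $ t = w $ n $ t - x $ n $ t" by (simp add: d_def)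
        have v: "v $ n $ t = w $ n $ t - s * e $ n $ t" by (simp add: v_def)
        consider "e $ n $ t = 0" | "e $ n $ t > 0" | "e $ n $ t < 0" by linarith
        then have "\<bar>v $ n $ t - x $ n $ t\<bar> = \<bar>w $ n $ t - x $ n $ t\<bar> - s * \<bar>e $ n $ t\<bar> \<and>
          min (x $ n $ t) (w $ n $ t) \<le> v $ n $ t \<and> v $ n $ t \<le> max (x $ n $ t) (w $ n $ t)"
        proof cases
          case 1
          then show ?thesis by (simp add: v)
        next
          case 2
          then have "0 < s * e $ n $ t" "s * e $ n $ t \<le> w $ n $ t - x $ n $ t"
            using \<open>s > 0\<close> sgn(1)[OF 2] s_le[of n t] d by simp_all
          with 2 show ?thesis unfolding v by linarith
        next
          case 3
          then have "s * e $ n $ t < 0" "w $ n $ t - x $ n $ t \<le> s * e $ n $ t"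
            using \<open>s > 0\<close> sgn(2)[OF 3] s_le[of n t] d by (simp_all add: mult_pos_neg)
          with 3 show ?thesis unfolding v by (simp add: abs_if)
        qed
        then show "\<bar>v $ n $ t - x $ n $ t\<bar> = \<bar>w $ n $ t - x $ n $ t\<bar> - s * \<bar>e $ n $ t\<bar>"
          "min (x $ n $ t) (w $ n $ t) \<le> v $ n $ t \<and> v $ n $ t \<le> max (x $ n $ t) (w $ n $ t)" by auto
      qed
      have "(\<Sum>t\<in>UNIV. v $ n $ t) = E $ n" for n
        using w(1) e(1) by (simp add: v_def sum_subtractf sum_distrib_left[symmetric] mem_X sign_cone_def)
      moreover have "lo $ n $ t \<le> v $ n $ t \<and> v $ n $ t \<le> hi $ n $ t" for n t
      proof -
        have "lo $ n $ t \<le> x $ n $ t" "x $ n $ t \<le> hi $ n $ t" "lo $ n $ t \<le> w $ n $ t" "w $ n $ t \<le> hi $ n $ t"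
          using w(1) x by (auto simp: mem_X)
        with between[of n t] show ?thesis by linarith
      qed
      ultimately have "v \<in> X" by (simp add: mem_X)
      moreover have "total v = total w0"
        using w(2) e(2) by (simp add: v_def total_diff total_scaleR)
      ultimately have "h w \<le> h v" by (rule min)
      moreover have "h v = h w - s * (\<Sum>n\<in>UNIV. \<Sum>t\<in>UNIV. \<bar>e $ n $ t\<bar>)"
        by (simp add: h_def abs_v sum_subtractf sum_distrib_left)
      moreover have "norm e > 0" using \<open>e \<noteq> 0\<close> by simp
      then have "(\<Sum>n\<in>UNIV. \<Sum>t\<in>UNIV. \<bar>e $ n $ t\<bar>) > 0"
        using norm_le_sum_entries[of e] by linarith
      then have "s * (\<Sum>n\<in>UNIV. \<Sum>t\<in>UNIV. \<bar>e $ n $ t\<bar>) > 0"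
        using \<open>s > 0\<close> by simp
      ultimately show False by simp
    qed
    then have "norm (w - x) \<le> C * norm (total (w - x))"
      using C mem by blast
    with w show ?thesis by (auto simp: total_diff)
  qed
  with \<open>C > 0\<close> show ?thesis by blast
qed

text \<open>One iteration from \<open>x\<close> to the next \<open>x\<close>, with the projection
  onto the disaggregations made explicit. Estimates for it hold for every \<open>x\<close>, whatever
  the starting point and history.\<close>

definition apm_step :: "real^'t \<Rightarrow> real^'t^'n \<Rightarrow> real^'t^'n" where
  "apm_step p x = closest_point X (x + vec (gap p x))"

lemma apm_step_mem: "apm_step p x \<in> X"
  unfolding apm_step_def by (intro closest_point_in_set closed_X X_nonempty)

lemma apm_step_dot: "w \<in> X \<Longrightarrow> (x + vec (gap p x) - apm_step p x) \<bullet> (w - apm_step p x) \<le> 0"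
  unfolding apm_step_def by (intro closest_point_dot convex_X closed_X)

text \<open>With \<open>1 < K\<close>, the predecessor \<open>K - 1\<close> is at least 1 and so
  indexes a genuine iterate.\<close>

lemma apm_x_eq_apm_step:
  assumes "1 < K"
  shows "apm_x X (disaggregations p) y0 K = apm_step p (apm_x X (disaggregations p) y0 (K - 1))"
proof -
  obtain k where "K = Suc k" "k \<ge> 1"
    using assms by (cases K) auto
  then show ?thesis
    by (simp add: apm_x_Suc closest_point_disaggregations apm_step_def)
qed

lemma apm_x_in_X: "apm_x X (disaggregations p) y0 K \<in> X"
  by (intro apm_x_mem closed_X X_nonempty)

lemma nrm_apm_diff:
  assumes "1 \<le> K"
  shows "nrm (apm_x X (disaggregations p) y0 K - apm_y X (disaggregations p) y0 K) =
    nrm (vec (gap p (apm_x X (disaggregations p) y0 K)))"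
  using is_norm_minus[OF nrm, of "vec (gap p (apm_x X (disaggregations p) y0 K))"]
  by (simp add: apm_y_eq_closest_point[OF assms] closest_point_disaggregations)

text \<open>The factor N by which \<open>total\<close> may stretch norms cancels against the
  division by N in \<open>gap\<close>.\<close>

lemma gap_apm_step_diff:
  "norm (gap p (apm_step p x) - gap p x) \<le> norm (apm_step p x - x)"
proof -
  have "gap p (apm_step p x) - gap p x = (1 / real CARD('n)) *\<^sub>R total (x - apm_step p x)"
    by (simp add: gap_def total_diff algebra_simps)
  then have "norm (gap p (apm_step p x) - gap p x) = norm (total (x - apm_step p x)) / real CARD('n)"
    by simp
  also have "\<dots> \<le> norm (x - apm_step p x)"
    using norm_total_le[of "x - apm_step p x"] by (simp add: field_simps)
  finally show ?thesis by (simp add: norm_minus_commute)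
qed

subsection \<open>Termination of NI-APM\<close>

text \<open>Since \<nu> sums to zero, an upper bound on its entries also bounds them from below. The
  whole gap is then of order \<open>eps\<close>, with a constant independent of \<open>p\<close> and
  \<open>x\<close>.\<close>

lemma large_gap_large_tolerance:
  assumes "B > 0" "dis > 0"
  shows "\<exists>\<eta>>0. \<forall>p\<in>P. \<forall>x\<in>X. \<forall>eps>0.
    (\<forall>t. imbalance p x t \<le> B * eps) \<longrightarrow> dis < nrm (vec (gap p x)) \<longrightarrow> \<eta> < eps"
proof -
  obtain c where c: "c > 0" "\<And>x. nrm x \<le> c * norm x"
    using is_norm_upper[OF nrm] by blast
  let ?T = "real CARD('t)"
  \<comment> \<open>The factors come from norm equivalence, copying the gap to all users, summing
    its entries, and bounding each entry through the zero sum.\<close>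
  let ?D = "c * (real CARD('n) * (?T * (?T * B)))"
  have D: "?D > 0" using c assms by simp
  have "dis / ?D < eps"
    if p: "p \<in> P" and x: "x \<in> X" and eps: "eps > 0"
      and le: "\<And>t. imbalance p x t \<le> B * eps" and dis: "dis < nrm (vec (gap p x))" for p x eps
  proof -
    have abs: "\<bar>gap p x $ t\<bar> \<le> ?T * (B * eps)" for t
    proof -
      have "B * eps - imbalance p x t \<le> (\<Sum>s\<in>UNIV. B * eps - imbalance p x s)"
        by (rule member_le_sum) (simp_all add: le)
      also have "\<dots> = ?T * (B * eps)"
        using sum_imbalance[OF x p] by (simp add: sum_subtractf)
      finally have "B * eps - imbalance p x t \<le> ?T * (B * eps)" .
      moreover have "0 \<le> B * eps" using assms eps by simp
      moreover have "1 * (B * eps) \<le> ?T * (B * eps)"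
        by (rule mult_right_mono) (use assms eps in \<open>simp_all add: Suc_leI\<close>)
      ultimately show ?thesis using le[of t] by (simp add: gap_nth abs_le_iff)
    qed
    have "norm (gap p x) \<le> (\<Sum>t\<in>UNIV. \<bar>gap p x $ t\<bar>)"
      by (rule norm_le_l1_cart)
    also have "\<dots> \<le> ?T * (?T * (B * eps))"
      by (rule sum_bounded_above) (rule abs)
    finally have g: "norm (gap p x) \<le> ?T * (?T * (B * eps))" .
    have "nrm (vec (gap p x)) \<le> c * norm (vec (gap p x) :: real^'t^'n)"
      by (rule c)
    also have "\<dots> \<le> c * (real CARD('n) * norm (gap p x))"
      using c by (intro mult_left_mono norm_vec_le) simp
    also have "\<dots> \<le> c * (real CARD('n) * (?T * (?T * (B * eps))))"
      using c by (intro mult_left_mono g) simp_all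
    finally have "dis < ?D * eps"
      using dis by (simp add: mult_ac)
    then show ?thesis using D by (simp add: pos_divide_less_eq mult_ac)
  qed
  with D assms show ?thesis
    by (intro exI[of _ "dis / ?D"]) (auto intro: divide_pos_pos)
qed

text \<open>All imbalances on \<open>S\<close> are positive, so a nonempty \<open>S\<close> would
  give a violated cut. Hence a refinement only occurs when no imbalance exceeds
  \<open>B * eps\<close>.\<close>

lemma no_positive_imbalance_if_no_cut:
  fixes x :: "real^'t^'n"
  assumes "\<not> load_on S x < (\<Sum>t\<in>S. p $ t)" and "S = {t. B * eps < imbalance p x t}"
    and "0 \<le> B * eps"
  shows "S = {}"
proof (rule ccontr)
  assume "S \<noteq> {}"
  then have "(\<Sum>t\<in>S. imbalance p x t) > 0"
    using assms(2,3) by (intro sum_pos) auto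
  then have "real CARD('n) * (\<Sum>t\<in>S. imbalance p x t) > 0" by simp
  then show False
    using sum_minus_load_on[of p S x] assms(1) by simp
qed

text \<open>Refinement happens only at tolerances above \<eta>. One \<eta> serves all of
  \<open>P\<close>, since the master solution varies during a run.\<close>

definition tolerance_bound :: "real \<Rightarrow> real \<Rightarrow> real \<Rightarrow> bool" where
  "tolerance_bound B dis \<eta> \<longleftrightarrow> 0 < \<eta> \<and> (\<forall>p\<in>P. \<forall>x\<in>X. \<forall>eps>0.
     \<not> nrm (vec (gap p x)) \<le> dis \<longrightarrow>
     \<not> load_on {t. B * eps < imbalance p x t} x < (\<Sum>t\<in>{t. B * eps < imbalance p x t}. p $ t) \<longrightarrow>
     \<eta> < eps)"

lemma tolerance_bound_exists:
  assumes "B > 0" "dis > 0"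
  shows "\<exists>\<eta>. tolerance_bound B dis \<eta>"
proof -
  obtain \<eta> where \<eta>: "\<eta> > 0" "\<And>p x eps. p \<in> P \<Longrightarrow> x \<in> X \<Longrightarrow> eps > 0 \<Longrightarrow>
    (\<forall>t. imbalance p x t \<le> B * eps) \<Longrightarrow> dis < nrm (vec (gap p x)) \<Longrightarrow> \<eta> < eps"
    using large_gap_large_tolerance[OF assms] by blast
  have "\<eta> < eps"
    if "p \<in> P" "x \<in> X" "eps > 0" "\<not> nrm (vec (gap p x)) \<le> dis"
      and no_cut: "\<not> load_on {t. B * eps < imbalance p x t} x < (\<Sum>t\<in>{t. B * eps < imbalance p x t}. p $ t)"
    for p x eps
  proof -
    have "{t. B * eps < imbalance p x t} = {}"
      using no_positive_imbalance_if_no_cut[OF no_cut refl] assms that by simp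
    then have "\<forall>t. imbalance p x t \<le> B * eps" by (auto simp: not_less)
    with \<eta>(2) that show ?thesis by simp
  qed
  with \<eta>(1) show ?thesis unfolding tolerance_bound_def by blast
qed

lemma ni_apm_from_progress:
  assumes \<eta>: "tolerance_bound B dis \<eta>" and p: "p \<in> P" and "0 < eps" "1 \<le> k"
  shows "(\<exists>r. ni_apm_from X nrm B dis p y0 eps k r) \<or>
    \<eta> < eps \<and> (\<exists>K>k. \<forall>r. ni_apm_from X nrm B dis p y0 (eps / 2) K r \<longrightarrow> ni_apm_from X nrm B dis p y0 eps k r)"
proof -
  let ?x = "apm_x X (disaggregations p) y0"
  \<comment> \<open>This is the equal split of \<open>p\<close> among the users.\<close>
  have "vec (gap p (0 :: real^'t^'n)) \<in> (disaggregations p :: (real^'t^'n) set)"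
    using total_gap[of p "0 :: real^'t^'n"]
    by (simp add: mem_disaggregations total_vec linear_0[OF linear_total])
  then have "disaggregations p \<noteq> ({} :: (real^'t^'n) set)" by blast
  then obtain K where K: "next_small_step nrm ?x eps k K"
    using next_small_step_exists[OF nrm assms(3)
        apm_increment_tendsto_zero[OF convex_X closed_X X_nonempty closed_disaggregations]] by blast
  then have "k < K" by (simp add: next_small_step_def)
  let ?S = "{t. B * eps < imbalance p (?x K) t}"
  consider "nrm (?x K - apm_y X (disaggregations p) y0 K) \<le> dis"
    | "\<not> nrm (?x K - apm_y X (disaggregations p) y0 K) \<le> dis" "load_on ?S (?x K) < (\<Sum>t\<in>?S. p $ t)"
    | "\<not> nrm (?x K - apm_y X (disaggregations p) y0 K) \<le> dis" "\<not> load_on ?S (?x K) < (\<Sum>t\<in>?S. p $ t)"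
    by blast
  then show ?thesis
  proof cases
    case 1
    then show ?thesis using ni_apm_from.accept[OF K] by blast
  next
    case 2
    then show ?thesis using ni_apm_from.cut[OF K refl _ refl] by blast
  next
    case 3
    have "\<not> nrm (vec (gap p (?x K))) \<le> dis"
      using 3(1) nrm_apm_diff[of K p y0] \<open>k < K\<close> assms(4) by simp
    then have "\<eta> < eps"
      using \<eta> p apm_x_in_X[of p y0 K] 3(2) assms(3) unfolding tolerance_bound_def by blast
    then show ?thesis
      using ni_apm_from.refine[OF K refl _ refl] 3 \<open>k < K\<close> by blast
  qed
qed

text \<open>\<open>m\<close> bounds the number of halvings left: at a tolerance of at most \<eta> no
  refinement is possible.\<close>

lemma ni_apm_from_terminates:
  assumes \<eta>: "tolerance_bound B dis \<eta>" and p: "p \<in> P"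
  shows "0 < eps \<Longrightarrow> 1 \<le> k \<Longrightarrow> eps \<le> 2 ^ m * \<eta> \<Longrightarrow> \<exists>r. ni_apm_from X nrm B dis p y0 eps k r"
proof (induction m arbitrary: eps k)
  case (0 eps k)
  then show ?case
    using ni_apm_from_progress[OF \<eta> p 0(1,2)] by fastforce
next
  case (Suc m eps k)
  have "\<exists>r. ni_apm_from X nrm B dis p y0 (eps / 2) K r" if "k < K" for K
    using Suc.prems that by (intro Suc.IH) auto
  then show ?case
    using ni_apm_from_progress[OF \<eta> p Suc.prems(1,2)] by blast
qed

text \<open>The final tolerance is the initial one or half of one above \<eta>, which gives the
  lower bound on \<open>eps'\<close>. The cut is described through a single \<open>apm_step\<close>,
  so the history disappears.\<close>

lemma ni_apm_from_cutD:
  assumes "ni_apm_from X nrm B dis p y0 eps k r" and "r = Cut S A"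
    and \<eta>: "tolerance_bound B dis \<eta>" and p: "p \<in> P" and "0 < eps" "1 \<le> k"
  shows "\<exists>eps' x. min eps (\<eta> / 2) \<le> eps' \<and> eps' \<le> eps \<and> nrm (apm_step p x - x) < eps' \<and>
    S = {t. B * eps' < imbalance p (apm_step p x) t} \<and> A = load_on S (apm_step p x) \<and>
    A < (\<Sum>t\<in>S. p $ t)"
  using assms(1,2,5,6)
proof (induction)
  case (accept eps k K)
  then show ?case by simp
next
  case (cut eps k K x S')
  have "1 < K"
    using cut by (simp add: next_small_step_def)
  note step = apm_x_eq_apm_step[OF this, of p y0]
  show ?case
    using cut step unfolding next_small_step_def
    by (intro exI[of _ eps] exI[of _ "apm_x X (disaggregations p) y0 (K - 1)"]) auto
next
  case (refine eps k K x S' r)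
  have K: "1 \<le> K" using refine by (simp add: next_small_step_def)
  have "\<not> nrm (vec (gap p x)) \<le> dis"
    using refine nrm_apm_diff[OF K] by simp
  moreover have "x \<in> X" using refine apm_x_in_X by simp
  ultimately have "\<eta> < eps"
    using \<eta> p refine unfolding tolerance_bound_def by blast
  moreover obtain eps' z where "min (eps / 2) (\<eta> / 2) \<le> eps'" "eps' \<le> eps / 2"
    "nrm (apm_step p z - z) < eps'" "S = {t. B * eps' < imbalance p (apm_step p z) t}"
    "A = load_on S (apm_step p z)" "A < (\<Sum>t\<in>S. p $ t)"
    using refine.IH refine.prems K by auto
  ultimately show ?case
    using refine.prems by (intro exI[of _ eps'] exI[of _ z]) auto
qed

subsection \<open>Exactness of the cuts for small tolerances\<close>

text \<open>This is \<open>\<nu>\<^sub>\<infinity>\<close>: the gap left by the attainable total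
  nearest to \<open>p\<close>. It depends on \<open>p\<close> only.\<close>

definition limit_gap :: "real^'t \<Rightarrow> real^'t" where
  "limit_gap p = (1 / real CARD('n)) *\<^sub>R (p - closest_point (total ` X) p)"

text \<open>Two projection inequalities are combined: that of \<open>z\<close> onto
  \<open>X\<close>, tested at a nearby profile with the optimal total \<open>q\<close>, and that of
  \<open>q\<close>, tested at \<open>total z\<close>. Together they bound the squared error by a
  multiple of error times increment.\<close>

lemma limit_gap_error_bound:
  "\<exists>C>0. \<forall>p x. norm (gap p (apm_step p x) - limit_gap p) \<le> C * norm (apm_step p x - x)"
proof -
  obtain C where "C > 0" and C: "\<And>x w0. x \<in> X \<Longrightarrow> w0 \<in> X \<Longrightarrow>
      \<exists>w\<in>X. total w = total w0 \<and> norm (w - x) \<le> C * norm (total w0 - total x)"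
    using nearby_profile_with_total by blast
  have "norm (gap p (apm_step p x) - limit_gap p) \<le> (1 + real CARD('n)) * C * norm (apm_step p x - x)" for p x
  proof -
    define z where "z = apm_step p x"
    define q where "q = closest_point (total ` X) p"
    have z: "z \<in> X" by (simp add: z_def apm_step_mem)
    have closed: "closed (total ` X)"
      by (intro compact_imp_closed compact_continuous_image continuous_on_total compact_X)
    have convex: "convex (total ` X)"
      by (intro convex_linear_image linear_total convex_X)
    have "q \<in> total ` X"
      unfolding q_def using closed X_nonempty by (intro closest_point_in_set) auto
    then obtain w where w: "w \<in> X" "total w = q" "norm (w - z) \<le> C * norm (q - total z)"
      using C[OF z] by (metis imageE)
    define \<delta> where "\<delta> = gap p z - limit_gap p"
    have \<delta>: "q - total z = real CARD('n) *\<^sub>R \<delta>"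
      by (simp add: \<delta>_def gap_def limit_gap_def q_def algebra_simps)
    \<comment> \<open>This yields \<open>limit_gap p \<bullet> \<delta> \<ge> 0\<close>, so that
      \<open>gap p z \<bullet> \<delta>\<close> is at least the square of
      \<open>norm \<delta>\<close>.\<close>
    have "(p - q) \<bullet> (total z - q) \<le> 0"
      unfolding q_def using z by (intro closest_point_dot convex closed) simp
    moreover have "p - q = real CARD('n) *\<^sub>R limit_gap p" "total z - q = - (real CARD('n) *\<^sub>R \<delta>)"
      using \<delta> by (simp_all add: limit_gap_def q_def algebra_simps)
    ultimately have "real CARD('n) * (real CARD('n) * (limit_gap p \<bullet> \<delta>)) \<ge> 0" by simp
    then have lim: "limit_gap p \<bullet> \<delta> \<ge> 0"
      by (simp add: zero_le_mult_iff)
    let ?r = "norm (z - x)"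
    have "0 \<ge> (x + vec (gap p x) - z) \<bullet> (w - z)"
      unfolding z_def using w(1) by (rule apm_step_dot)
    \<comment> \<open>The residual of the projection is \<open>vec (gap p z)\<close> up to two terms
      controlled by the increment \<open>z - x\<close>.\<close>
    also have "(x + vec (gap p x) - z) \<bullet> (w - z) =
        gap p z \<bullet> (q - total z) - (gap p z - gap p x) \<bullet> total (w - z) - (z - x) \<bullet> (w - z)"
      using w(2) by (simp add: inner_diff_left inner_add_left inner_vec_left total_diff)
    finally have "gap p z \<bullet> (q - total z) \<le> (gap p z - gap p x) \<bullet> total (w - z) + (z - x) \<bullet> (w - z)"
      by simp
    also have "\<dots> \<le> norm (gap p z - gap p x) * norm (total (w - z)) + ?r * norm (w - z)"
      by (intro add_mono norm_cauchy_schwarz)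
    also have "\<dots> \<le> ?r * (real CARD('n) * norm (w - z)) + ?r * norm (w - z)"
      unfolding z_def by (intro add_mono mult_mono gap_apm_step_diff norm_total_le) simp_all
    also have "\<dots> = ((1 + real CARD('n)) * ?r) * norm (w - z)"
      by (simp add: algebra_simps)
    also have "\<dots> \<le> ((1 + real CARD('n)) * ?r) * (C * norm (q - total z))"
      using w(3) by (intro mult_left_mono) simp_all
    finally have "real CARD('n) * (gap p z \<bullet> \<delta>) \<le> real CARD('n) * ((1 + real CARD('n)) * C * ?r * norm \<delta>)"
      by (simp add: \<delta> mult_ac)
    then have "gap p z \<bullet> \<delta> \<le> (1 + real CARD('n)) * C * ?r * norm \<delta>"
      by simp
    moreover have "gap p z = limit_gap p + \<delta>" by (simp add: \<delta>_def)
    then have "gap p z \<bullet> \<delta> = limit_gap p \<bullet> \<delta> + norm \<delta> * norm \<delta>"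
      by (simp add: inner_add_left dot_square_norm power2_eq_square)
    ultimately have "norm \<delta> * norm \<delta> \<le> ((1 + real CARD('n)) * C * ?r) * norm \<delta>"
      using lim by linarith
    then have "norm \<delta> \<le> (1 + real CARD('n)) * C * ?r"
      using \<open>C > 0\<close> by (cases "\<delta> = 0") simp_all
    then show ?thesis by (simp add: \<delta>_def z_def)
  qed
  moreover have "(1 + real CARD('n)) * C > 0" using \<open>C > 0\<close> by (simp add: add_pos_nonneg)
  ultimately show ?thesis by blast
qed

text \<open>First-order optimality of the projection, tested against moving load between \<open>t0\<close> and \<open>t1\<close>.\<close>

lemma apm_step_exchange:
  assumes slack: "apm_step p x $ n $ t0 < hi $ n $ t0" "lo $ n $ t1 < apm_step p x $ n $ t1"
    and "t0 \<noteq> t1"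
  shows "gap p (apm_step p x) $ t0 - gap p (apm_step p x) $ t1 \<le> 4 * norm (apm_step p x - x)"
proof -
  define z where "z = apm_step p x"
  \<comment> \<open>The largest amount user \<open>n\<close> can move from \<open>t1\<close> to
    \<open>t0\<close> within the bounds.\<close>
  define s where "s = min (hi $ n $ t0 - z $ n $ t0) (z $ n $ t1 - lo $ n $ t1)"
  define d :: "real^'t^'n" where "d = axis n (axis t0 1 - axis t1 1)"
  have d: "d $ m $ t = (if m = n then (if t = t0 then 1 else 0) - (if t = t1 then 1 else 0) else 0)" for m t
    by (simp add: d_def axis_def)
  have s: "s > 0" "s \<le> hi $ n $ t0 - z $ n $ t0" "s \<le> z $ n $ t1 - lo $ n $ t1"
    using slack by (auto simp: s_def z_def)
  have z: "z \<in> X" by (simp add: z_def apm_step_mem)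
  have "(\<Sum>t\<in>UNIV. d $ m $ t) = 0" for m
    by (cases "m = n") (simp_all add: d sum_subtractf)
  then have "(\<Sum>t\<in>UNIV. (z + s *\<^sub>R d) $ m $ t) = E $ m" for m
    using z by (simp add: mem_X sum.distrib sum_distrib_left[symmetric])
  moreover have "lo $ m $ t \<le> (z + s *\<^sub>R d) $ m $ t \<and> (z + s *\<^sub>R d) $ m $ t \<le> hi $ m $ t" for m t
  proof -
    have "lo $ m $ t \<le> z $ m $ t \<and> z $ m $ t \<le> hi $ m $ t" using z by (simp add: mem_X)
    then show ?thesis using s \<open>t0 \<noteq> t1\<close> by (auto simp: d)
  qed
  ultimately have "z + s *\<^sub>R d \<in> X" by (simp add: mem_X)
  then have "(x + vec (gap p x) - z) \<bullet> (z + s *\<^sub>R d - z) \<le> 0"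
    unfolding z_def by (rule apm_step_dot)
  then have "s * ((x + vec (gap p x) - z) \<bullet> d) \<le> 0" by simp
  then have "(x + vec (gap p x) - z) \<bullet> d \<le> 0"
    using s(1) by (simp add: mult_le_0_iff)
  then have "gap p x $ t0 - gap p x $ t1 \<le> (z - x) $ n $ t0 - (z - x) $ n $ t1"
    by (simp add: d_def inner_axis inner_diff_right)
  \<comment> \<open>The factor 4 arises as 2 from the entries of \<open>z - x\<close> and 2 from
    replacing the gap at \<open>x\<close> by the gap at \<open>z\<close>.\<close>
  moreover have "\<bar>(z - x) $ n $ t\<bar> \<le> norm (z - x)" for t
    by (rule abs_entry_le_norm)
  from this[of t0] this[of t1]
  have "(z - x) $ n $ t0 - (z - x) $ n $ t1 \<le> 2 * norm (z - x)" by linarith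
  moreover have "\<bar>gap p z $ t - gap p x $ t\<bar> \<le> norm (z - x)" for t
    using Finite_Cartesian_Product.norm_nth_le[of "gap p z - gap p x" t] gap_apm_step_diff[of p x]
    by (simp add: z_def)
  from this[of t0] this[of t1]
  have "(gap p z $ t0 - gap p z $ t1) - (gap p x $ t0 - gap p x $ t1) \<le> 2 * norm (z - x)" by linarith
  ultimately show ?thesis
    unfolding z_def[symmetric] by linarith
qed

text \<open>By the exchange estimate, each user is at the upper bound throughout \<open>S\<close> or
  at the lower bound throughout the complement. Either way the user's load on \<open>S\<close> is
  maximal, the energy being fixed.\<close>

lemma load_on_maximal:
  assumes sep: "\<And>t0 t1. t0 \<in> S \<Longrightarrow> t1 \<notin> S \<Longrightarrow>
      4 * norm (apm_step p x - x) < gap p (apm_step p x) $ t0 - gap p (apm_step p x) $ t1"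
    and w: "w \<in> X"
  shows "load_on S w \<le> load_on S (apm_step p x)"
proof -
  define z where "z = apm_step p x"
  have z: "z \<in> X" by (simp add: z_def apm_step_mem)
  have "(\<Sum>t\<in>S. w $ n $ t) \<le> (\<Sum>t\<in>S. z $ n $ t)" for n
  proof (cases "\<forall>t\<in>S. z $ n $ t = hi $ n $ t")
    case True
    then show ?thesis using w by (intro sum_mono) (simp add: mem_X)
  next
    case False
    then obtain t0 where t0: "t0 \<in> S" "z $ n $ t0 < hi $ n $ t0"
      using z by (auto simp: mem_X order_less_le)
    have "z $ n $ t = lo $ n $ t" if "t \<notin> S" for t
    proof (rule ccontr)
      assume "z $ n $ t \<noteq> lo $ n $ t"
      then have "lo $ n $ t < z $ n $ t" using z by (auto simp: mem_X order_less_le)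
      moreover have "t0 \<noteq> t" using t0 that by blast
      ultimately show False
        using apm_step_exchange[of p x n t0 t] t0 sep[OF t0(1) that] by (simp add: z_def)
    qed
    then have "(\<Sum>t\<in>- S. z $ n $ t) \<le> (\<Sum>t\<in>- S. w $ n $ t)"
      using w by (intro sum_mono) (simp add: mem_X)
    moreover have "(\<Sum>t\<in>S. v $ n $ t) + (\<Sum>t\<in>- S. v $ n $ t) = E $ n" if "v \<in> X" for v
      using that sum.subset_diff[of S UNIV "\<lambda>t. v $ n $ t"]
      by (simp add: mem_X Compl_eq_Diff_UNIV)
    from this[OF z] this[OF w] show ?thesis
      using calculation by linarith
  qed
  then have "(\<Sum>n\<in>UNIV. \<Sum>t\<in>S. w $ n $ t) \<le> (\<Sum>n\<in>UNIV. \<Sum>t\<in>S. z $ n $ t)"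
    by (rule sum_mono)
  then show ?thesis
    unfolding load_on_def z_def[symmetric] by (subst (1 2) sum.swap)
qed

definition max_load :: "'t set \<Rightarrow> real" where
  "max_load S = Sup (load_on S ` X)"

text \<open>\<open>B0\<close> does not depend on \<open>p\<close>, whereas \<open>cvg0\<close> does,
  through the smallest positive entry of \<open>limit_gap p\<close>.\<close>

lemma exact_cuts:
  "\<exists>B0>0. \<forall>B\<ge>B0. \<forall>p. \<exists>cvg0>0. \<forall>eps x. nrm (apm_step p x - x) < eps \<longrightarrow> eps \<le> cvg0 \<longrightarrow>
     (\<forall>S. S = {t. B * eps < imbalance p (apm_step p x) t} \<longrightarrow> load_on S (apm_step p x) = max_load S)"
proof -
  obtain c where c: "c > 0" "\<And>x. norm x \<le> c * nrm x"
    using is_norm_lower[OF nrm] by blast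
  obtain C where C: "C > 0" "\<And>p x. norm (gap p (apm_step p x) - limit_gap p) \<le> C * norm (apm_step p x - x)"
    using limit_gap_error_bound by blast
  \<comment> \<open>\<open>c\<close> passes from \<open>nrm\<close> to the Euclidean norm and
    \<open>C\<close> from the increment to the error of the gap.\<close>
  define B1 where "B1 = C * c"
  have B1: "B1 > 0" using c C by (simp add: B1_def)
  show ?thesis
  proof (rule exI[of _ "B1 + 4 * c"], intro conjI allI impI)
    show "B1 + 4 * c > 0" using B1 c by simp
    fix B p assume B: "B1 + 4 * c \<le> B"
    define pos where "pos = {t. 0 < limit_gap p $ t}"
    \<comment> \<open>The inserted 1 covers the case that \<open>limit_gap p\<close> has no positive
      entry.\<close>
    define \<nu> where "\<nu> = Min (insert 1 ((\<lambda>t. limit_gap p $ t) ` pos))"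
    have \<nu>: "\<nu> > 0" "\<And>t. 0 < limit_gap p $ t \<Longrightarrow> \<nu> \<le> limit_gap p $ t"
      unfolding \<nu>_def by (subst Min_gr_iff) (auto simp: pos_def intro!: Min_le)
    have BB: "B + B1 > 0" using B B1 c by linarith
    show "\<exists>cvg0>0. \<forall>eps x. nrm (apm_step p x - x) < eps \<longrightarrow> eps \<le> cvg0 \<longrightarrow>
     (\<forall>S. S = {t. B * eps < imbalance p (apm_step p x) t} \<longrightarrow> load_on S (apm_step p x) = max_load S)"
    proof (intro exI[of _ "\<nu> / (B + B1)"] conjI allI impI)
      show "\<nu> / (B + B1) > 0" using \<nu> BB by simp
      fix eps x S
      assume small: "nrm (apm_step p x - x) < eps" and eps: "eps \<le> \<nu> / (B + B1)"
        and S: "S = {t. B * eps < imbalance p (apm_step p x) t}"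
      define z where "z = apm_step p x"
      have r: "norm (z - x) < c * eps"
        using c(2)[of "z - x"] mult_strict_left_mono[OF small c(1)] by (simp add: z_def)
      have err: "\<bar>gap p z $ t - limit_gap p $ t\<bar> < B1 * eps" for t
      proof -
        have "\<bar>gap p z $ t - limit_gap p $ t\<bar> \<le> norm (gap p z - limit_gap p)"
          using Finite_Cartesian_Product.norm_nth_le[of "gap p z - limit_gap p" t] by simp
        also have "\<dots> \<le> C * norm (z - x)" unfolding z_def by (rule C)
        also have "\<dots> < B1 * eps"
          using mult_strict_left_mono[OF r C(1)] by (simp add: B1_def mult_ac)
        finally show ?thesis .
      qed
      have "eps > 0" using small is_norm_nonneg[OF nrm, of "apm_step p x - x"] by simp
      have sep: "4 * norm (z - x) < gap p z $ t0 - gap p z $ t1" if "t0 \<in> S" "t1 \<notin> S" for t0 t1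
      proof -
        have t0: "B * eps < gap p z $ t0" and t1: "gap p z $ t1 \<le> B * eps"
          using that by (auto simp: S z_def gap_nth)
        have "(B + B1) * eps \<le> \<nu>"
          using eps BB by (simp add: pos_le_divide_eq mult_ac)
        \<comment> \<open>The entry is below \<open>(B + B1) * eps\<close>, hence below the least
          positive value \<nu>. So the gap at \<open>t1\<close> falls under \<open>B1 * eps\<close>,
          leaving a separation of more than \<open>(B - B1) * eps\<close>.\<close>
        then have "\<not> 0 < limit_gap p $ t1"
          using \<nu>(2)[of t1] err[of t1] t1 by (auto simp: distrib_right)
        then have "gap p z $ t1 < B1 * eps" using err[of t1] by simp
        moreover have "(B1 + 4 * c) * eps \<le> B * eps"
          using B \<open>eps > 0\<close> by (intro mult_right_mono) simp_all
        ultimately show ?thesis using t0 r by (simp add: distrib_right)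
      qed
      have "load_on S w \<le> load_on S z" if "w \<in> X" for w
        unfolding z_def using sep that by (intro load_on_maximal) (auto simp: z_def)
      then show "load_on S (apm_step p x) = max_load S"
        unfolding max_load_def z_def[symmetric]
        by (intro cSup_eq_maximum[symmetric]) (auto simp: z_def apm_step_mem)
    qed
  qed
qed

text \<open>Bounds partial sums of \<open>p\<close> from above and, negated, cut right-hand sides
  from below; these are the two ends of the potential argument for runs.\<close>

definition load_bound :: real where
  "load_bound = (\<Sum>t\<in>UNIV. \<bar>\<Sum>n\<in>UNIV. lo $ n $ t\<bar> + \<bar>\<Sum>n\<in>UNIV. hi $ n $ t\<bar>)"

lemma sum_le_load_bound:
  assumes "p \<in> P"
  shows "(\<Sum>t\<in>S. p $ t) \<le> load_bound"
proof -
  have "(\<Sum>t\<in>S. p $ t) \<le> (\<Sum>t\<in>S. \<bar>\<Sum>n\<in>UNIV. lo $ n $ t\<bar> + \<bar>\<Sum>n\<in>UNIV. hi $ n $ t\<bar>)"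
  proof (rule sum_mono)
    show "p $ t \<le> \<bar>\<Sum>n\<in>UNIV. lo $ n $ t\<bar> + \<bar>\<Sum>n\<in>UNIV. hi $ n $ t\<bar>" for t
      using P_bounds[OF assms, of t] by linarith
  qed
  also have "\<dots> \<le> load_bound"
    unfolding load_bound_def by (rule sum_mono2) auto
  finally show ?thesis .
qed

lemma load_on_ge_load_bound:
  assumes "x \<in> X"
  shows "- load_bound \<le> load_on S x"
proof -
  have "- load_bound \<le> (\<Sum>t\<in>S. - (\<bar>\<Sum>n\<in>UNIV. lo $ n $ t\<bar> + \<bar>\<Sum>n\<in>UNIV. hi $ n $ t\<bar>))"
    unfolding load_bound_def sum_negf neg_le_iff_le by (rule sum_mono2) auto
  also have "\<dots> \<le> load_on S x"
    unfolding load_on_def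
  proof (rule sum_mono)
    fix t
    have "(\<Sum>n\<in>UNIV. lo $ n $ t) \<le> (\<Sum>n\<in>UNIV. x $ n $ t)"
      using assms by (intro sum_mono) (simp add: mem_X)
    then show "- (\<bar>\<Sum>n\<in>UNIV. lo $ n $ t\<bar> + \<bar>\<Sum>n\<in>UNIV. hi $ n $ t\<bar>) \<le> (\<Sum>n\<in>UNIV. x $ n $ t)"
      by linarith
  qed
  finally show ?thesis .
qed

lemma ni_apm_cutD:
  assumes "tolerance_bound B dis \<eta>" "p \<in> P" "0 < cvg"
    and "ni_apm X nrm B cvg dis p y0 (Cut S A)"
  obtains eps x where "min cvg (\<eta> / 2) \<le> eps" "eps \<le> cvg" "nrm (apm_step p x - x) < eps"
    "S = {t. B * eps < imbalance p (apm_step p x) t}" "A = load_on S (apm_step p x)"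
    "A < (\<Sum>t\<in>S. p $ t)"
  using ni_apm_from_cutD[OF assms(4)[unfolded ni_apm_def] refl assms(1-3)] by auto

text \<open>On the empty set and on all periods, \<open>p\<close> and the iterate carry the same
  load, so neither set gives a violated cut.\<close>

lemma ni_apm_cut_set:
  assumes "tolerance_bound B dis \<eta>" "p \<in> P" "0 < cvg"
    and "ni_apm X nrm B cvg dis p y0 (Cut S A)"
  shows "S \<noteq> {}" "S \<noteq> UNIV"
proof -
  obtain x where A: "A = load_on S (apm_step p x)" "A < (\<Sum>t\<in>S. p $ t)"
    using ni_apm_cutD[OF assms] by metis
  show "S \<noteq> {}" using A by (auto simp: load_on_def)
  show "S \<noteq> UNIV"
    using A load_on_UNIV[OF apm_step_mem, of p x] sum_P[OF assms(2)] by auto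
qed

text \<open>One period of \<open>S\<close> already contributes more than \<open>B * eps\<close> to
  the violation and the others contribute positively; \<open>eps\<close> is bounded below by
  \<open>ni_apm_cutD\<close>.\<close>

lemma ni_apm_cut_depth:
  assumes \<eta>: "tolerance_bound B dis \<eta>" and "p \<in> P" "0 < cvg" "0 < B"
    and "ni_apm X nrm B cvg dis p y0 (Cut S A)"
  shows "A + B * min cvg (\<eta> / 2) \<le> (\<Sum>t\<in>S. p $ t)" "- load_bound \<le> A"
proof -
  obtain eps x where eps: "min cvg (\<eta> / 2) \<le> eps"
    and S: "S = {t. B * eps < imbalance p (apm_step p x) t}"
    and A: "A = load_on S (apm_step p x)" "A < (\<Sum>t\<in>S. p $ t)"
    using ni_apm_cutD[OF assms(1-3,5)] by metis
  have "\<eta> > 0" using \<eta> by (simp add: tolerance_bound_def)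
  with \<open>0 < cvg\<close> eps have "0 < eps" by linarith
  then have "0 < B * eps" using \<open>0 < B\<close> by simp
  obtain t where t: "t \<in> S"
    using A by (cases "S = {}") (auto simp: load_on_def)
  let ?\<nu> = "imbalance p (apm_step p x)"
  have "B * min cvg (\<eta> / 2) \<le> B * eps"
    using eps \<open>0 < B\<close> by (intro mult_left_mono) simp_all
  also have "\<dots> \<le> ?\<nu> t" using t S by simp
  also have "\<dots> \<le> (\<Sum>t\<in>S. ?\<nu> t)"
    using t S \<open>0 < B * eps\<close> by (intro member_le_sum) auto
  also have "\<dots> \<le> real CARD('n) * (\<Sum>t\<in>S. ?\<nu> t)"
  proof -
    have "0 \<le> (\<Sum>t\<in>S. ?\<nu> t)"
      using S \<open>0 < B * eps\<close> by (intro sum_nonneg) auto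
    moreover have "1 \<le> real CARD('n)" by (simp add: Suc_leI)
    ultimately show ?thesis using mult_right_mono[of 1 "real CARD('n)"] by fastforce
  qed
  also have "\<dots> = (\<Sum>t\<in>S. p $ t) - A"
    using A by (simp add: sum_minus_load_on)
  finally show "A + B * min cvg (\<eta> / 2) \<le> (\<Sum>t\<in>S. p $ t)" by simp
  show "- load_bound \<le> A"
    using A load_on_ge_load_bound[OF apm_step_mem] by simp
qed

subsection \<open>Runs of the disaggregation algorithm\<close>

lemma nod_reaches_cut_set:
  assumes "tolerance_bound B dis \<eta>" "0 < cvg"
    and "nod_reaches X P f nrm B cvg dis sel start cs" "(S, A) \<in> set cs"
  shows "S \<in> UNIV - {{}, UNIV}"
  using assms(3,4)
proof induction
  case init
  then show ?case by simp
next
  case (add cs S' A')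
  then show ?case
    using ni_apm_cut_set[OF assms(1) master_solutionD(1) assms(2)] by fastforce
qed

text \<open>The right-hand sides recorded for a fixed \<open>S\<close> decrease by at least \<open>\<delta>\<close> each time, and they
  are bounded below.\<close>

lemma nod_reaches_length_bound:
  assumes \<eta>: "tolerance_bound B dis \<eta>" and cvg: "0 < cvg" and B: "0 < B"
    and "nod_reaches X P f nrm B cvg dis sel start cs"
  shows "real (length cs) * (B * min cvg (\<eta> / 2)) \<le> 2 * (2 ^ CARD('t) * load_bound)"
proof -
  define \<delta> where "\<delta> = B * min cvg (\<eta> / 2)"
  \<comment> \<open>The tightest right-hand side recorded for \<open>S\<close>, capped by
    \<open>load_bound\<close> so that it is defined before any cut on \<open>S\<close>. Its sum over
    all \<open>S\<close> is the potential.\<close>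
  define best where "best cs S = Min (insert load_bound (snd ` {c \<in> set cs. fst c = S}))"
    for cs :: "'t cuts" and S
  have "\<eta> > 0" using \<eta> by (simp add: tolerance_bound_def)
  then have \<delta>: "\<delta> > 0" using cvg B by (simp add: \<delta>_def)
  have nonneg: "0 \<le> load_bound" unfolding load_bound_def by (intro sum_nonneg) simp
  from assms(4) have "(\<Sum>S\<in>UNIV. best cs S) + real (length cs) * \<delta> \<le> 2 ^ CARD('t) * load_bound \<and>
    (\<forall>S. - load_bound \<le> best cs S)"
  proof induction
    case init
    then show ?case using nonneg by (simp add: best_def card_UNIV_set)
  next
    case (add cs S A)
    define p where "p = sel cs"
    have p: "p \<in> P" "\<And>A. (S, A) \<in> set cs \<Longrightarrow> (\<Sum>t\<in>S. p $ t) \<le> A"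
      using master_solutionD[OF add.hyps(2)] by (auto simp: p_def)
    have cut: "A + \<delta> \<le> (\<Sum>t\<in>S. p $ t)" "- load_bound \<le> A"
      using ni_apm_cut_depth[OF \<eta> p(1) cvg B] add.hyps(3) by (auto simp: \<delta>_def p_def)
    \<comment> \<open>The master solution obeys all earlier cuts on \<open>S\<close>, so a cut
      violated by \<delta> lowers \<open>best\<close> by at least \<delta>.\<close>
    have old: "(\<Sum>t\<in>S. p $ t) \<le> best cs S"
      unfolding best_def using p sum_le_load_bound by (subst Min_ge_iff) auto
    have "{c \<in> set (cs @ [(S, A)]). fst c = S} = insert (S, A) {c \<in> set cs. fst c = S}" by auto
    then have "best (cs @ [(S, A)]) S = min A (best cs S)"
      unfolding best_def by (simp add: insert_commute[of load_bound] del: set_append)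
    then have new: "best (cs @ [(S, A)]) S = A"
      using old cut(1) \<delta> by simp
    have other: "best (cs @ [(S, A)]) S' = best cs S'" if "S' \<noteq> S" for S'
    proof -
      have "{c \<in> set (cs @ [(S, A)]). fst c = S'} = {c \<in> set cs. fst c = S'}"
        using that by auto
      then show ?thesis unfolding best_def by simp
    qed
    have "(\<Sum>S'\<in>UNIV. best (cs @ [(S, A)]) S') \<le> (\<Sum>S'\<in>UNIV. best cs S' - (if S' = S then \<delta> else 0))"
      using new other old cut(1) by (intro sum_mono) auto
    also have "\<dots> = (\<Sum>S'\<in>UNIV. best cs S') - \<delta>"
      by (simp add: sum_subtractf)
    finally have "(\<Sum>S'\<in>UNIV. best (cs @ [(S, A)]) S') + real (length (cs @ [(S, A)])) * \<delta>
      \<le> 2 ^ CARD('t) * load_bound"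
      using add.IH by (simp add: distrib_right)
    moreover have "- load_bound \<le> best (cs @ [(S, A)]) S'" for S'
      using add.IH new other cut(2) by (cases "S' = S") auto
    ultimately show ?case by blast
  qed
  moreover from this have "(\<Sum>S\<in>(UNIV :: 't set set). - load_bound) \<le> (\<Sum>S\<in>UNIV. best cs S)"
    by (intro sum_mono) blast
  ultimately show ?thesis
    unfolding \<delta>_def by (simp add: card_UNIV_set)
qed

lemma finite_nod_reaches:
  assumes B: "0 < B" and cvg: "0 < cvg" and dis: "0 < dis"
  shows "finite {cs. nod_reaches X P f nrm B cvg dis sel start cs}"
proof -
  obtain \<eta> where \<eta>: "tolerance_bound B dis \<eta>"
    using tolerance_bound_exists[OF B dis] by blast
  define \<delta> where "\<delta> = B * min cvg (\<eta> / 2)"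
  have "\<eta> > 0" using \<eta> by (simp add: tolerance_bound_def)
  then have \<delta>: "\<delta> > 0" using cvg B by (simp add: \<delta>_def)
  define L where "L = nat \<lceil>2 * (2 ^ CARD('t) * load_bound) / \<delta>\<rceil>"
  have "length cs \<le> L" if "nod_reaches X P f nrm B cvg dis sel start cs" for cs
  proof -
    have "real (length cs) \<le> 2 * (2 ^ CARD('t) * load_bound) / \<delta>"
      using nod_reaches_length_bound[OF \<eta> cvg B that] \<delta>
      unfolding \<delta>_def[symmetric] by (simp add: pos_le_divide_eq)
    then show ?thesis unfolding L_def by linarith
  qed
  then have "length ` {cs. nod_reaches X P f nrm B cvg dis sel start cs} \<subseteq> {..L}"
    by auto
  then have "finite (length ` {cs. nod_reaches X P f nrm B cvg dis sel start cs})"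
    by (rule finite_subset) simp
  moreover have "inj_on length {cs. nod_reaches X P f nrm B cvg dis sel start cs}"
    by (rule inj_onI) (use nod_reaches_deterministic in blast)
  ultimately show ?thesis by (rule finite_imageD)
qed

text \<open>Take a longest reachable list. If its master problem is feasible, NI-APM answers, and a
  further cut would give a longer list.\<close>

lemma nod_stops:
  assumes B: "0 < B" and cvg: "0 < cvg" and dis: "0 < dis"
    and solvable: "\<And>cs. nod_reaches X P f nrm B cvg dis sel start cs \<Longrightarrow> master P cs \<noteq> {} \<Longrightarrow>
      master_solution P f cs (sel cs)"
  shows "\<exists>cs. nod_stops_with X P f nrm B cvg dis sel start cs"
proof -
  let ?R = "{cs. nod_reaches X P f nrm B cvg dis sel start cs}"
  have fin: "finite (length ` ?R)"
    using finite_nod_reaches[OF B cvg dis] by simp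
  have "[] \<in> ?R" by (simp add: nod_reaches.init)
  then have "Max (length ` ?R) \<in> length ` ?R"
    using fin by (intro Max_in) auto
  then obtain cs where cs: "nod_reaches X P f nrm B cvg dis sel start cs"
    and len: "length cs = Max (length ` ?R)" by auto
  have longest: "length cs' \<le> length cs" if "nod_reaches X P f nrm B cvg dis sel start cs'" for cs'
    unfolding len using that fin by (intro Max_ge) auto
  have "nod_stops_with X P f nrm B cvg dis sel start cs"
  proof (cases "master P cs = {}")
    case True
    with cs show ?thesis by (simp add: nod_stops_with_def)
  next
    case False
    with solvable cs have sol: "master_solution P f cs (sel cs)" by blast
    obtain \<eta> where \<eta>: "tolerance_bound B dis \<eta>"
      using tolerance_bound_exists[OF B dis] by blast
    then have "\<eta> > 0" by (simp add: tolerance_bound_def)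
    obtain m where "cvg / \<eta> < 2 ^ m"
      using real_arch_pow[of 2 "cvg / \<eta>"] by auto
    then have "cvg \<le> 2 ^ m * \<eta>"
      using \<open>\<eta> > 0\<close> by (simp add: pos_divide_less_eq)
    then obtain r where r: "ni_apm X nrm B cvg dis (sel cs) (start cs) r"
      using ni_apm_from_terminates[OF \<eta> master_solutionD(1)[OF sol] cvg] unfolding ni_apm_def by blast
    show ?thesis
    proof (cases r)
      case (Accept x)
      with r cs sol show ?thesis by (auto simp: nod_stops_with_def)
    next
      case (Cut S A)
      with r have "nod_reaches X P f nrm B cvg dis sel start (cs @ [(S, A)])"
        using nod_reaches.add[OF cs sol] by blast
      from longest[OF this] show ?thesis by simp
    qed
  qed
  then show ?thesis ..
qed

text \<open>This counts distinct sets and holds for all parameters; it does not exclude that a set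
  recurs with a smaller right-hand side.\<close>

lemma card_cut_sets_le:
  assumes B: "0 < B" and cvg: "0 < cvg" and dis: "0 < dis"
  shows "card {S. \<exists>cs A. nod_reaches X P f nrm B cvg dis sel start cs \<and> (S, A) \<in> set cs} \<le> 2 ^ CARD('t) - 2"
proof -
  obtain \<eta> where \<eta>: "tolerance_bound B dis \<eta>"
    using tolerance_bound_exists[OF B dis] by blast
  have "{S. \<exists>cs A. nod_reaches X P f nrm B cvg dis sel start cs \<and> (S, A) \<in> set cs} \<subseteq> UNIV - {{}, UNIV}"
    using nod_reaches_cut_set[OF \<eta> cvg] by blast
  from card_mono[OF _ this] show ?thesis
    by (simp only: card_proper_nonempty_sets finite)
qed

text \<open>As long as all cuts are exact, the list of cuts added is determined by a list of distinct
  sets. Hence only finitely many master solutions occur, and one tolerance serves them all.\<close>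

lemma nod_length_le:
  "\<exists>B0>0. \<forall>B\<ge>B0. \<forall>sel. \<exists>cvg0>0. \<forall>cvg dis start cs. 0 < cvg \<and> cvg \<le> cvg0 \<and> 0 < dis \<and>
     nod_reaches X P f nrm B cvg dis sel start cs \<longrightarrow> length cs \<le> 2 ^ CARD('t) - 2"
proof -
  define exact where "exact B p c \<longleftrightarrow> 0 < c \<and> (\<forall>eps x. nrm (apm_step p x - x) < eps \<longrightarrow> eps \<le> c \<longrightarrow>
     (\<forall>S. S = {t. B * eps < imbalance p (apm_step p x) t} \<longrightarrow> load_on S (apm_step p x) = max_load S))"
    for B p and c :: real
  obtain B0 where B0: "B0 > 0" "\<And>B p. B0 \<le> B \<Longrightarrow> \<exists>c. exact B p c"
    using exact_cuts unfolding exact_def by blast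
  define cuts where "cuts = map (\<lambda>S :: 't set. (S, max_load S))"
  have "\<exists>cvg0>0. \<forall>cvg dis start cs. 0 < cvg \<and> cvg \<le> cvg0 \<and> 0 < dis \<and>
     nod_reaches X P f nrm B cvg dis sel start cs \<longrightarrow> length cs \<le> 2 ^ CARD('t) - 2"
    if le: "B0 \<le> B" for B and sel :: "'t cuts \<Rightarrow> real^'t"
  proof -
    have B: "0 < B" using le B0(1) by simp
    obtain c where c: "\<And>p. exact B p (c p)"
      using B0(2)[OF le] by metis
    define D where "D = {Ss :: 't set list. distinct Ss}"
    have "D \<subseteq> {Ss. set Ss \<subseteq> UNIV \<and> length Ss \<le> CARD('t set)}"
    proof
      fix Ss assume "Ss \<in> D"
      then have "length Ss = card (set Ss)" by (simp add: D_def distinct_card)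
      also have "\<dots> \<le> CARD('t set)" by (rule card_mono) simp_all
      finally show "Ss \<in> {Ss. set Ss \<subseteq> UNIV \<and> length Ss \<le> CARD('t set)}" by simp
    qed
    then have "finite D"
      by (rule finite_subset) (rule finite_lists_length_le, simp)
    \<comment> \<open>The minimum runs over the master solutions selected after exact cuts on
      distinct sets. \<open>sel\<close> is fixed beforehand, so it is a minimum of finitely many
      values.\<close>
    define cvg0 where "cvg0 = Min (insert 1 ((\<lambda>Ss. c (sel (cuts Ss))) ` D))"
    have "cvg0 > 0"
      unfolding cvg0_def using \<open>finite D\<close> c by (subst Min_gr_iff) (auto simp: exact_def)
    have cvg0: "cvg0 \<le> c (sel (cuts Ss))" if "distinct Ss" for Ss
      unfolding cvg0_def using \<open>finite D\<close> that by (intro Min_le) (auto simp: D_def)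
    have "length cs \<le> 2 ^ CARD('t) - 2"
      if cvg: "0 < cvg" "cvg \<le> cvg0" and dis: "0 < dis"
        and cs: "nod_reaches X P f nrm B cvg dis sel start cs" for cvg dis start cs
    proof -
      obtain \<eta> where \<eta>: "tolerance_bound B dis \<eta>"
        using tolerance_bound_exists[OF B dis] by blast
      from cs have "\<exists>Ss. distinct Ss \<and> cs = cuts Ss"
      proof induction
        case init
        show ?case by (intro exI[of _ "[]"]) (simp add: cuts_def)
      next
        case (add cs S A)
        then obtain Ss where Ss: "distinct Ss" "cs = cuts Ss" by blast
        note sol = master_solutionD[OF add.hyps(2)]
        obtain eps x where eps: "eps \<le> cvg" "nrm (apm_step (sel cs) x - x) < eps"
          and S: "S = {t. B * eps < imbalance (sel cs) (apm_step (sel cs) x) t}"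
          and A: "A = load_on S (apm_step (sel cs) x)" "A < (\<Sum>t\<in>S. sel cs $ t)"
          using ni_apm_cutD[OF \<eta> sol(1) cvg(1) add.hyps(3)] by metis
        have "eps \<le> c (sel cs)"
          using eps(1) cvg(2) cvg0[OF Ss(1)] Ss(2) by simp
        then have "A = max_load S"
          using c[of "sel cs"] eps(2) S A(1) unfolding exact_def by blast
        \<comment> \<open>An exact cut on a repeated set would coincide with an earlier one, which
          the master solution satisfies.\<close>
        moreover have "S \<notin> set Ss"
        proof
          assume "S \<in> set Ss"
          then have "(S, A) \<in> set cs"
            using Ss(2) \<open>A = max_load S\<close> by (simp add: cuts_def)
          from sol(2)[OF this] A(2) show False by simp
        qed
        ultimately show ?case
          using Ss by (intro exI[of _ "Ss @ [S]"]) (simp add: cuts_def)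
      qed
      then obtain Ss where Ss: "distinct Ss" "cs = cuts Ss" by blast
      have "set Ss \<subseteq> UNIV - {{}, UNIV}"
      proof
        fix S assume "S \<in> set Ss"
        then have "(S, max_load S) \<in> set cs" using Ss(2) by (simp add: cuts_def)
        then show "S \<in> UNIV - {{}, UNIV}"
          by (rule nod_reaches_cut_set[OF \<eta> cvg(1) cs])
      qed
      from card_mono[OF _ this] have "card (set Ss) \<le> 2 ^ CARD('t) - 2"
        by (simp only: card_proper_nonempty_sets finite)
      then show ?thesis
        using Ss by (simp add: distinct_card cuts_def)
    qed
    with \<open>cvg0 > 0\<close> show ?thesis by blast
  qed
  with B0(1) show ?thesis by blast
qed

end

theorem proposition3p12:
  fixes E :: "real^'n::finite"
    and lo hi :: "real^'t::finite^'n"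
    and P :: "(real^'t) set"
    and f :: "real^'t \<Rightarrow> real"
    and nrm :: "real^'t^'n \<Rightarrow> real"
  assumes "\<And>n. E $ n > 0"
    and "\<And>n. user_set (E $ n) (lo $ n) (hi $ n) \<noteq> {}"
    and "\<And>p. p \<in> P \<Longrightarrow> (\<Sum>t\<in>UNIV. p $ t) = (\<Sum>n\<in>UNIV. E $ n)"
    and "\<And>p t. p \<in> P \<Longrightarrow>
           (\<Sum>n\<in>UNIV. lo $ n $ t) \<le> p $ t \<and> p $ t \<le> (\<Sum>n\<in>UNIV. hi $ n $ t)"
    and "is_norm nrm"
  defines "reaches \<equiv> nod_reaches (profiles E lo hi) P f nrm"
    and "stops_with \<equiv> nod_stops_with (profiles E lo hi) P f nrm"
  shows "(\<forall>B>0. \<forall>cvg>0. \<forall>dis>0. \<forall>sel start.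
            finite {cs. reaches B cvg dis sel start cs} \<and>
            ((\<forall>cs. reaches B cvg dis sel start cs \<longrightarrow> master P cs \<noteq> {} \<longrightarrow>
                master_solution P f cs (sel cs)) \<longrightarrow>
              (\<exists>cs. stops_with B cvg dis sel start cs)) \<and>
            card {S. \<exists>cs A. reaches B cvg dis sel start cs \<and> (S, A) \<in> set cs} \<le> 2 ^ CARD('t) - 2) \<and>
         (\<exists>B0>0. \<forall>B\<ge>B0. \<forall>sel. \<exists>cvg0>0. \<forall>cvg dis start cs.
            0 < cvg \<and> cvg \<le> cvg0 \<and> 0 < dis \<and> reaches B cvg dis sel start cs \<longrightarrow>
            length cs \<le> 2 ^ CARD('t) - 2)"
proof -
  interpret disaggregation_problem E lo hi P nrm
    by unfold_locales (use assms in auto)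
  show ?thesis
    unfolding reaches_def stops_with_def
    by (intro conjI allI impI finite_nod_reaches nod_stops card_cut_sets_le nod_length_le) auto
qed

end
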